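(* Let $n\ge 0$ be an integer, $\nu\in\mathbb{R}$, and $t\in\mathbb{C}$ with $\Re t>0$. Then the $n$-th derivative with respect to the order of the Bessel function of the second kind is $$\frac{\partial^{n}}{\partial\nu^{n}}Y_{\nu}(t)=\frac{1}{\pi}\int_{0}^{\pi}x^{n}\sin\left(t\sin x-\nu x-\frac{\pi}{2}n\right)dx-\frac{1}{\pi}\int_{0}^{\infty}e^{-t\sinh x}\left(x^{n}e^{\nu x}+e^{-\nu x}\,\Re\left[(i\pi-x)^{n}e^{i\pi\nu}\right]\right)dx .$$
   Context: $J_\nu(t)=\left(\frac t2\right)^{\nu}\sum_{k=0}^{\infty}\frac{(-1)^k(t/2)^{2k}}{k!\,\Gamma(\nu+k+1)}$ is the Bessel function of the first kind (principal branch of the power, $1/\Gamma$ taken to be $0$ at the poles of $\Gamma$). The Bessel function of the second kind is $Y_\nu(t)=\frac{J_\nu(t)\cos\pi\nu-J_{-\nu}(t)}{\sin\pi\nu}$ for $\nu\notin\mathbb{Z}$, extended to integer $\nu$ by taking the limit in $\nu$. $\Re$ denotes the real part. *)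

theory Defs
  imports "HOL-Analysis.Analysis"
begin

text \<open>
  The order is real and the argument complex. \<^const>\<open>rGamma\<close> is the entire function
  \<open>1 / \<Gamma>\<close>, which vanishes at the poles of \<open>\<Gamma>\<close>, and \<open>powr\<close> on complex numbers is the
  principal branch of the power.
\<close>

definition bessel_J :: "real \<Rightarrow> complex \<Rightarrow> complex" where
  "bessel_J \<nu> t = (t / 2) powr (of_real \<nu>) *
     (\<Sum>k. (-1) ^ k * (t / 2) ^ (2 * k) / fact k * rGamma (of_real \<nu> + of_nat k + 1))"

definition bessel_Y_quotient :: "real \<Rightarrow> complex \<Rightarrow> complex" where
  "bessel_Y_quotient \<nu> t =
     (bessel_J \<nu> t * of_real (cos (pi * \<nu>)) - bessel_J (- \<nu>) t) / of_real (sin (pi * \<nu>))"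

definition bessel_Y :: "real \<Rightarrow> complex \<Rightarrow> complex" where
  "bessel_Y \<nu> t =
     (if \<nu> \<in> \<int> then Lim (at \<nu>) (\<lambda>\<mu>. bessel_Y_quotient \<mu> t) else bessel_Y_quotient \<nu> t)"

text \<open>
  \<^const>\<open>deriv\<close> does not apply to complex-valued functions of a real variable, so the
  \<open>n\<close>-th derivative iterates \<^const>\<open>vector_derivative\<close>. Since that is a total function,
  existence of the derivatives is the separate predicate \<open>times_differentiable\<close>.
\<close>

definition nth_derivative :: "nat \<Rightarrow> (real \<Rightarrow> complex) \<Rightarrow> real \<Rightarrow> complex" where
  "nth_derivative n f = ((\<lambda>g x. vector_derivative g (at x)) ^^ n) f"

definition times_differentiable :: "nat \<Rightarrow> (real \<Rightarrow> complex) \<Rightarrow> bool" where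
  "times_differentiable n f \<longleftrightarrow> (\<forall>k<n. \<forall>x. nth_derivative k f differentiable (at x))"

end

theory Submission
  imports Defs
begin

text \<open>
  Hankel's loop integral for \<open>1 / \<Gamma>(\<nu> + 1)\<close>, taken over a circle and the two sides of the cut
  and rescaled by \<open>R\<close> with \<open>Re R > 0\<close>, reads \<open>H(R, \<nu>) = R powr \<nu> / \<Gamma>(\<nu> + 1)\<close>. No contour
  deformation is needed: integration by parts gives \<open>\<nu> H(R, \<nu>) = R H(R, \<nu> - 1)\<close>, while
  differentiation in \<open>R\<close> gives \<open>H'(R, \<nu>) = H(R, \<nu> - 1)\<close>, so \<open>H(R, \<nu>)\<close> is a constant times
  \<open>R powr \<nu>\<close>. For \<open>-1 < \<nu> < 0\<close> the constant is the limit as \<open>R\<close> tends to \<open>0\<close>, where Euler's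
  integral and the reflection formula apply, and the recurrence reaches all other orders.

  Substituting this into the power series of \<open>J\<close> with \<open>R = t / 2\<close> yields Schlaefli's integral
  for \<open>J\<close>, hence the case \<open>n = 0\<close> for non-integer \<open>\<nu>\<close>. Its right-hand side is a combination of
  integrals \<open>\<integral> g(x) exp (\<nu> b(x))\<close>, each smooth in \<open>\<nu>\<close>; continuity covers the integer orders and
  differentiation under the integral sign the case of general \<open>n\<close>.
\<close>

section \<open>Integrals of exponentials\<close>

text \<open>The weight \<open>exp (d * norm b)\<close> is spent in two halves: one bounds the
  exponential in the Taylor remainder, the other absorbs \<open>norm b ^ 2\<close>. The constant
  \<open>8 / d ^ 2\<close> comes from y^2 / 2 \<le> exp y at y = d |b| / 2.\<close>

lemma norm_exp_minus_linear_le: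
  fixes h b :: complex
  assumes d: "0 < d" "norm h \<le> d / 2"
  shows "norm (exp (h * b) - 1 - h * b) \<le> norm h ^ 2 * (8 / d ^ 2) * exp (d * norm b)"
proof -
  have 1: "norm (exp (h * b) - (\<Sum>i\<le>1. (h * b) ^ i / fact i)) \<le> exp (norm (h * b)) * norm (h * b) ^ Suc 1 / fact 1"
    by (rule Taylor_exp_field)
  have "norm (exp (h * b) - 1 - h * b) \<le> exp (norm h * norm b) * (norm h ^ 2 * norm b ^ 2)"
    using 1 by (simp add: norm_mult power2_eq_square algebra_simps)
  also have "\<dots> \<le> exp (d / 2 * norm b) * (norm h ^ 2 * (8 / d ^ 2 * exp (d / 2 * norm b)))"
  proof (intro mult_mono)
    show "exp (norm h * norm b) \<le> exp (d / 2 * norm b)"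
      using mult_right_mono[OF d(2) norm_ge_zero] by simp
    have "1 + d / 2 * norm b + (d / 2 * norm b) ^ 2 / 2 \<le> exp (d / 2 * norm b)"
      by (rule exp_lower_Taylor_quadratic) (use d in auto)
    then have "(d / 2 * norm b) ^ 2 / 2 \<le> exp (d / 2 * norm b)"
      using d by (smt (verit) divide_nonneg_nonneg mult_nonneg_nonneg norm_ge_zero)
    then show "norm b ^ 2 \<le> 8 / d ^ 2 * exp (d / 2 * norm b)"
      using d by (simp add: field_simps power_mult_distrib)
  qed auto
  also have "\<dots> = norm h ^ 2 * (8 / d ^ 2) * exp (d / 2 * norm b + d / 2 * norm b)"
    by (simp only: exp_add) (simp add: algebra_simps)
  finally show ?thesis by (simp add: algebra_simps)
qed

lemma norm_le_exp_norm:
  fixes b :: complex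
  assumes "0 < d"
  shows "norm b \<le> 1 / d * exp (d * norm b)"
  using assms exp_ge_add_one_self[of "d * norm b"] by (simp add: field_simps del: exp_ge_add_one_self)

text \<open>Differentiation under the integral sign. Spare room \<open>exp (d * norm (b x))\<close>
  in the integrand dominates both the integrands at nearby parameters and the second-order
  remainder, so integrating the pointwise estimate leaves an error of order |h|^2.\<close>

lemma has_field_derivative_exp_integral:
  fixes g b :: "'a \<Rightarrow> complex" and z :: complex
  assumes [measurable]: "g \<in> borel_measurable M" "b \<in> borel_measurable M"
    and d: "0 < d"
    and int: "integrable M (\<lambda>x. norm (g x) * exp (Re (z * b x)) * exp (d * norm (b x)))"
  shows "((\<lambda>w. \<integral>x. g x * exp (w * b x) \<partial>M) has_field_derivative
           (\<integral>x. g x * b x * exp (z * b x) \<partial>M)) (at z)"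
proof -
  define D where "D = (\<lambda>x. norm (g x) * exp (Re (z * b x)) * exp (d * norm (b x)))"
  have D: "integrable M D" "D \<in> borel_measurable M" using int by (auto simp: D_def)
  have i1: "integrable M (\<lambda>x. g x * exp (w * b x))" if w: "norm (w - z) \<le> d" for w
  proof (rule Bochner_Integration.integrable_bound[OF D(1)], measurable, intro AE_I2)
    fix x
    have "Re (w * b x) = Re (z * b x) + Re ((w - z) * b x)" by (simp add: algebra_simps)
    also have "Re ((w - z) * b x) \<le> d * norm (b x)"
      using complex_Re_le_cmod[of "(w - z) * b x"] w mult_right_mono[OF w norm_ge_zero, of "b x"]
      by (simp add: norm_mult)
    finally have "exp (Re (w * b x)) \<le> exp (Re (z * b x)) * exp (d * norm (b x))"
      by (simp flip: exp_add)
    then show "norm (g x * exp (w * b x)) \<le> norm (D x)"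
      by (simp add: norm_mult D_def mult.assoc mult_left_mono del: times_complex.simps)
  qed
  have i2: "integrable M (\<lambda>x. g x * b x * exp (z * b x))"
  proof (rule Bochner_Integration.integrable_bound[of M "\<lambda>x. 1 / d * D x"], use D in simp, measurable, intro AE_I2)
    fix x
    have "norm (g x * b x * exp (z * b x)) = norm (g x) * exp (Re (z * b x)) * norm (b x)"
      by (simp add: norm_mult)
    also have "\<dots> \<le> norm (g x) * exp (Re (z * b x)) * (1 / d * exp (d * norm (b x)))"
      by (intro mult_left_mono norm_le_exp_norm d) auto
    finally show "norm (g x * b x * exp (z * b x)) \<le> norm (1 / d * D x)"
      using d by (simp add: D_def mult_ac)
  qed
  let ?F = "\<lambda>w. \<integral>x. g x * exp (w * b x) \<partial>M" and ?F' = "\<integral>x. g x * b x * exp (z * b x) \<partial>M"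
  define K where "K = 8 / d ^ 2 * integral\<^sup>L M D"
  have bound: "norm (?F (z + h) - ?F z - h * ?F') \<le> norm h ^ 2 * K" if h: "norm h \<le> d / 2" for h
  proof -
    have hd: "norm h \<le> d" using h norm_ge_zero[of h] by linarith
    have "?F (z + h) - ?F z - h * ?F' =
      (\<integral>x. g x * exp ((z + h) * b x) - g x * exp (z * b x) - h * (g x * b x * exp (z * b x)) \<partial>M)"
      using i1[of "z + h"] i1[of z] i2 d hd by simp
    then have "norm (?F (z + h) - ?F z - h * ?F') \<le> (\<integral>x. norm (g x * exp ((z + h) * b x) - g x * exp (z * b x) - h * (g x * b x * exp (z * b x))) \<partial>M)"
      by (simp only: integral_norm_bound)
    also have "\<dots> \<le> (\<integral>x. norm h ^ 2 * (8 / d ^ 2) * D x \<partial>M)"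
    proof (rule integral_mono)
      show "integrable M (\<lambda>x. norm (g x * exp ((z + h) * b x) - g x * exp (z * b x) - h * (g x * b x * exp (z * b x))))"
        using i1[of "z + h"] i1[of z] i2 d hd by simp
      show "integrable M (\<lambda>x. norm h ^ 2 * (8 / d ^ 2) * D x)" using D by simp
      fix x
      have "g x * exp ((z + h) * b x) - g x * exp (z * b x) - h * (g x * b x * exp (z * b x)) =
        g x * exp (z * b x) * (exp (h * b x) - 1 - h * b x)"
        by (simp add: algebra_simps exp_add)
      also have "norm \<dots> = norm (g x) * exp (Re (z * b x)) * norm (exp (h * b x) - 1 - h * b x)"
        by (simp add: norm_mult)
      also have "\<dots> \<le> norm (g x) * exp (Re (z * b x)) * (norm h ^ 2 * (8 / d ^ 2) * exp (d * norm (b x)))"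
        by (intro mult_left_mono norm_exp_minus_linear_le d h) auto
      finally show "norm (g x * exp ((z + h) * b x) - g x * exp (z * b x) - h * (g x * b x * exp (z * b x)))
          \<le> norm h ^ 2 * (8 / d ^ 2) * D x"
        by (simp add: D_def mult_ac)
    qed
    also have "\<dots> = norm h ^ 2 * K" by (simp add: K_def)
    finally show ?thesis .
  qed
  have "((\<lambda>h. (?F (z + h) - ?F z) / h - ?F') \<longlongrightarrow> 0) (at 0)"
  proof (rule Lim_null_comparison)
    show "\<forall>\<^sub>F h in at 0. norm ((?F (z + h) - ?F z) / h - ?F') \<le> norm h * K"
      unfolding eventually_at
    proof (intro exI[of _ "d / 2"] conjI ballI impI)
      fix h :: complex assume h: "h \<noteq> 0 \<and> dist h 0 < d / 2"
      then have "norm ((?F (z + h) - ?F z) / h - ?F') = norm (?F (z + h) - ?F z - h * ?F') / norm h"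
        by (simp add: field_simps flip: norm_divide)
      also have "\<dots> \<le> norm h ^ 2 * K / norm h"
        using bound[of h] h by (intro divide_right_mono) auto
      finally show "norm ((?F (z + h) - ?F z) / h - ?F') \<le> norm h * K"
        using h by (simp add: power2_eq_square)
    qed (use d in auto)
    show "((\<lambda>h::complex. norm h * K) \<longlongrightarrow> 0) (at 0)"
      by (intro tendsto_mult_left_zero tendsto_norm_zero tendsto_ident_at)
  qed
  then show ?thesis
    unfolding DERIV_def by (rule LIM_zero_cancel)
qed

text \<open>The exponential series is integrated term by term. Since |u| \<le> 1, the k-th term is
  dominated by |z|^k / k! times the integrable |g|, which permits exchanging sum and
  integral.\<close>

lemma sums_integral_exp:
  fixes g u :: "'a \<Rightarrow> complex" and z :: complex
  assumes g: "integrable M g" and [measurable]: "u \<in> borel_measurable M"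
    and u: "\<And>x. x \<in> space M \<Longrightarrow> norm (u x) \<le> 1"
  shows "(\<lambda>k. z ^ k / fact k * (\<integral>x. g x * u x ^ k \<partial>M)) sums (\<integral>x. g x * exp (z * u x) \<partial>M)"
proof -
  have [measurable]: "g \<in> borel_measurable M" using g by auto
  have le: "norm (z ^ k / fact k * (g x * u x ^ k)) \<le> norm z ^ k / fact k * norm (g x)" if "x \<in> space M" for k x
  proof -
    have "norm (u x) ^ k \<le> 1" using u[OF that] by (simp add: power_le_one)
    then have "norm (g x) * norm (u x) ^ k \<le> norm (g x)"
      by (simp add: mult_left_le)
    then have "norm z ^ k / fact k * (norm (g x) * norm (u x) ^ k) \<le> norm z ^ k / fact k * norm (g x)"
      by (intro mult_left_mono) auto
    then show ?thesis
      by (simp add: norm_mult norm_divide norm_power)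
  qed
  have i: "integrable M (\<lambda>x. z ^ k / fact k * (g x * u x ^ k))" for k
    by (rule Bochner_Integration.integrable_bound[of M "\<lambda>x. norm z ^ k / fact k * norm (g x)"])
       (use g le in \<open>auto intro!: AE_I2 simp: abs_mult\<close>)
  have s: "summable (\<lambda>k. norm z ^ k / fact k * B)" for B
    using summable_exp_generic[of "norm z"] by (intro summable_mult2) (simp add: field_simps scaleR_conv_of_real)
  have "(\<lambda>k. \<integral>x. z ^ k / fact k * (g x * u x ^ k) \<partial>M) sums (\<integral>x. (\<Sum>k. z ^ k / fact k * (g x * u x ^ k)) \<partial>M)"
  proof (rule sums_integral[OF i])
    show "AE x in M. summable (\<lambda>k. norm (z ^ k / fact k * (g x * u x ^ k)))"
      by (intro AE_I2 summable_comparison_test'[OF s]) (use le in auto)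
    have "(\<integral>x. norm (z ^ k / fact k * (g x * u x ^ k)) \<partial>M) \<le> (\<integral>x. norm z ^ k / fact k * norm (g x) \<partial>M)" for k
      by (rule integral_mono) (use i g le in auto)
    then show "summable (\<lambda>k. \<integral>x. norm (z ^ k / fact k * (g x * u x ^ k)) \<partial>M)"
      by (intro summable_comparison_test'[OF s[of "\<integral>x. norm (g x) \<partial>M"]]) auto
  qed
  moreover have "(\<Sum>k. z ^ k / fact k * (g x * u x ^ k)) = g x * exp (z * u x)" for x
  proof -
    have "(\<lambda>k. g x * ((z * u x) ^ k /\<^sub>R fact k)) sums (g x * exp (z * u x))"
      by (intro sums_mult exp_converges)
    also have "(\<lambda>k. g x * ((z * u x) ^ k /\<^sub>R fact k)) = (\<lambda>k. z ^ k / fact k * (g x * u x ^ k))"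
      by (auto simp: scaleR_conv_of_real field_simps)
    finally show ?thesis by (rule sums_unique[symmetric])
  qed
  ultimately show ?thesis by simp
qed

section \<open>Integrals over the half-line under a Gaussian bound\<close>

lemma integrable_halfline_quadratic:
  fixes f :: "real \<Rightarrow> 'b::euclidean_space"
  assumes f: "continuous_on {0..} f" and q: "q > 0"
    and le: "\<And>x. x \<ge> 0 \<Longrightarrow> norm (f x) \<le> exp (c * x - q * x ^ 2)"
  shows "integrable (lebesgue_on {0..}) f"
proof -
  have le': "norm (f x) \<le> exp ((c + 1) ^ 2 / (4 * q)) * exp (- 1 * x)" if "x \<ge> 0" for x
  proof -
    \<comment> \<open>Completing the square in (c + 1) x - q x^2 leaves a spare -x, so a multiple of
      exp (-x) dominates.\<close>
    have "c * x - q * x ^ 2 = (c + 1) ^ 2 / (4 * q) - x - q * (x - (c + 1) / (2 * q)) ^ 2"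
      using q by (simp add: field_simps power2_eq_square)
    also have "\<dots> \<le> (c + 1) ^ 2 / (4 * q) + - 1 * x"
      using q by simp
    finally show ?thesis
      using le[OF that] by (smt (verit) exp_add exp_le_cancel_iff)
  qed
  have "(\<lambda>x::real. exp (- 1 * x)) absolutely_integrable_on {0..}"
    by (intro nonnegative_absolutely_integrable_1 integrable_on_exp_minus_to_infinity) auto
  then have i: "integrable (lebesgue_on {0..}) (\<lambda>x::real. exp (- 1 * x))"
    by (rule absolutely_integrable_imp_integrable) auto
  show ?thesis
  proof (rule Bochner_Integration.integrable_bound)
    show "integrable (lebesgue_on {0..}) (\<lambda>x. exp ((c + 1) ^ 2 / (4 * q)) * exp (- 1 * x))"
      using i by simp
    show "f \<in> borel_measurable (lebesgue_on {0..})"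
      by (intro continuous_imp_measurable_on_sets_lebesgue f) auto
  qed (use le' in \<open>auto intro!: AE_I2\<close>)
qed

lemma exp_ge_half_square:
  fixes x :: real assumes "x \<ge> 0" shows "x ^ 2 / 2 \<le> exp x"
  using exp_lower_Taylor_quadratic[OF assms] assms by linarith

text \<open>A quadratic lower bound is enough for \<open>integrable_halfline_quadratic\<close>,
  since it beats every linear exponent.\<close>

lemma sinh_ge_quarter_square:
  fixes x :: real assumes "x \<ge> 0" shows "x ^ 2 / 4 \<le> sinh x"
proof -
  have "exp (-x) \<le> 1" using assms by simp
  then show ?thesis
    using exp_lower_Taylor_quadratic[OF assms] assms unfolding sinh_field_def by argo
qed

text \<open>Integrability makes the integrals over {0..b} converge to the one over the half-line.
  This serves integration by parts along the ray, where the boundary term at infinity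
  vanishes.\<close>

lemma integral_halfline_FTC:
  fixes f F :: "real \<Rightarrow> complex"
  assumes F: "\<And>x. x \<ge> 0 \<Longrightarrow> (F has_vector_derivative f x) (at x)"
    and f: "integrable (lebesgue_on {0..}) f"
    and lim: "(F \<longlongrightarrow> 0) at_top"
  shows "(\<integral>x. f x \<partial>lebesgue_on {0..}) = - F 0"
proof -
  have f': "set_integrable lebesgue {0..} f"
    using f by (simp add: set_integrable_def integrable_restrict_space)
  have "((\<lambda>b. LINT x:{0..b}|lebesgue. f x) \<longlongrightarrow> (LINT x:{0..}|lebesgue. f x)) at_top"
    by (rule tendsto_set_lebesgue_integral_at_top[OF _ f']) auto
  moreover have "\<forall>\<^sub>F b in at_top. (LINT x:{0..b}|lebesgue. f x) = F b - F 0"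
    using eventually_ge_at_top[of 0]
  proof eventually_elim
    case (elim b)
    have "set_integrable lebesgue {0..b} f"
      by (rule set_integrable_subset[OF f']) auto
    then have "(LINT x:{0..b}|lebesgue. f x) = integral {0..b} f"
      by (rule set_lebesgue_integral_eq_integral)
    also have "\<dots> = F b - F 0"
      using elim F by (intro integral_unique fundamental_theorem_of_calculus)
        (auto intro: has_vector_derivative_at_within)
    finally show ?case .
  qed
  ultimately have "((\<lambda>b. F b - F 0) \<longlongrightarrow> (LINT x:{0..}|lebesgue. f x)) at_top"
    using tendsto_cong by fast
  moreover have "((\<lambda>b. F b - F 0) \<longlongrightarrow> 0 - F 0) at_top"
    by (intro tendsto_intros lim)
  ultimately have "(LINT x:{0..}|lebesgue. f x) = 0 - F 0"
    using tendsto_unique trivial_limit_at_top_linorder by blast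
  then show ?thesis
    by (simp add: integral_restrict_space set_lebesgue_integral_def)
qed

section \<open>Hankel's integral\<close>

text \<open>Arises from the integral of u powr (-\<nu> - 1) exp (R u) over the unit circle: du =
  \<i> u d\<theta> absorbs one power of u, so the phase is exp (-\<i> \<nu> \<theta>).\<close>

definition circle_int :: "complex \<Rightarrow> real \<Rightarrow> complex" where
  "circle_int R \<nu> =
     (\<integral>\<theta>. exp (- (\<i> * of_real (\<nu> * \<theta>))) * exp (R * exp (\<i> * of_real \<theta>)) \<partial>lebesgue_on {-pi..pi})"

definition ray_int :: "complex \<Rightarrow> real \<Rightarrow> complex" where
  "ray_int R \<nu> =
     (\<integral>x. exp (- of_real (\<nu> * x)) * exp (R * (- of_real (exp x))) \<partial>lebesgue_on {0..})"

text \<open>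
  The loop is \<open>s = R u\<close>, where \<open>u\<close> comes in from \<open>-\<infinity>\<close> below the cut, runs once round the unit
  circle as \<open>u = exp (\<i> \<theta>)\<close>, and returns above the cut. On the two sides \<open>u = exp (x \<plusminus> \<i> \<pi>)\<close>,
  so the phases of \<open>u powr (- \<nu>)\<close> combine to the factor \<open>sin (\<pi> \<nu>)\<close>.
\<close>
definition hankel_int :: "complex \<Rightarrow> real \<Rightarrow> complex" where
  "hankel_int R \<nu> = circle_int R \<nu> / (2 * pi) - sin (pi * \<nu>) / pi * ray_int R \<nu>"

section \<open>Derivative of Hankel's integral in \<open>R\<close> and its recurrence in the
  order\<close>

lemma continuous_measurable_lebesgue_on:
  fixes f :: "real \<Rightarrow> complex"
  assumes "continuous_on S f" "S \<in> sets borel"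
  shows "f \<in> borel_measurable (lebesgue_on S)"
  using assms by (intro continuous_imp_measurable_on_sets_lebesgue) auto

text \<open>Differentiation brings down exp (\<i> \<theta>), which merges with the phase and lowers
  the order by one.\<close>

lemma has_field_derivative_circle_int:
  "((\<lambda>w. circle_int w \<nu>) has_field_derivative circle_int R (\<nu> - 1)) (at R)"
proof -
  have "circle_int R (\<nu> - 1) = (\<integral>\<theta>. exp (- (\<i> * of_real (\<nu> * \<theta>))) * exp (\<i> * of_real \<theta>)
          * exp (R * exp (\<i> * of_real \<theta>)) \<partial>lebesgue_on {-pi..pi})"
    unfolding circle_int_def
    by (intro Bochner_Integration.integral_cong refl) (simp add: algebra_simps flip: exp_add)
  then show ?thesis
    unfolding circle_int_def
    by (simp only:) (intro has_field_derivative_exp_integral[where d = 1] continuous_imp_integrable_real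
        continuous_measurable_lebesgue_on continuous_intros; simp)
qed

lemma norm_ray_integrand_le:
  fixes s x :: real
  assumes "s \<ge> 0" "x \<ge> 0"
  shows "exp (- (\<nu> * x)) * exp (- (s * exp x)) \<le> exp ((- \<nu>) * x - s / 2 * x ^ 2)"
  using mult_left_mono[OF exp_ge_half_square[OF assms(2)] assms(1)] by (simp flip: exp_add)

lemma integrable_ray_int:
  assumes "Re R > 0"
  shows "integrable (lebesgue_on {0..}) (\<lambda>x. exp (- of_real (\<nu> * x)) * exp (R * (- of_real (exp x))))"
  using assms norm_ray_integrand_le[of "Re R" _ \<nu>]
  by (intro integrable_halfline_quadratic[where q = "Re R / 2" and c = "- \<nu>"] continuous_intros)
     (auto simp: norm_mult)

lemma has_field_derivative_ray_int:
  assumes R: "Re R > 0"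
  shows "((\<lambda>w. ray_int w \<nu>) has_field_derivative - ray_int R (\<nu> - 1)) (at R)"
proof -
  have "- ray_int R (\<nu> - 1) = (\<integral>x. exp (- of_real (\<nu> * x)) * (- of_real (exp x))
          * exp (R * (- of_real (exp x))) \<partial>lebesgue_on {0..})"
    unfolding ray_int_def integral_minus[symmetric] exp_of_real[symmetric]
    by (intro Bochner_Integration.integral_cong refl)
       (simp add: algebra_simps flip: exp_add)
  then show ?thesis
    unfolding ray_int_def
    apply (simp only:)
    \<comment> \<open>Differentiation brings down -exp x, whose norm equals the decay rate up to
      \<open>Re R\<close>. With d = Re R / 2, half of the decay pays for the domination and the
      other half remains; the bound exp x \<ge> x^2 / 2 then gives q = Re R / 4.\<close>
    apply (intro has_field_derivative_exp_integral[where d = "Re R / 2"]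
        continuous_measurable_lebesgue_on continuous_intros
        integrable_halfline_quadratic[where q = "Re R / 4" and c = "- \<nu>"])
    using R norm_ray_integrand_le[of "Re R / 2" _ \<nu>]
    by (auto simp: mult.assoc simp flip: exp_add)
qed

text \<open>The minus sign in the derivative of the ray part is absorbed by the sine, which changes
  sign when the order drops by one.\<close>

lemma has_field_derivative_hankel_int:
  assumes R: "Re R > 0"
  shows "((\<lambda>w. hankel_int w \<nu>) has_field_derivative hankel_int R (\<nu> - 1)) (at R)"
proof -
  have "((\<lambda>w. circle_int w \<nu> / (2 * pi) - sin (pi * \<nu>) / pi * ray_int w \<nu>) has_field_derivative
          circle_int R (\<nu> - 1) / (2 * pi) - sin (pi * \<nu>) / pi * (- ray_int R (\<nu> - 1))) (at R)"
    by (intro DERIV_diff DERIV_cdivide DERIV_cmult has_field_derivative_circle_int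
        has_field_derivative_ray_int R)
  moreover have "sin (pi * (\<nu> - 1)) = - sin (pi * \<nu>)"
    by (simp add: right_diff_distrib sin_diff)
  ultimately show ?thesis
    by (simp add: hankel_int_def)
qed

text \<open>Integrating the \<theta>-derivative of the integrand expresses a boundary difference.
  Both endpoints lie over u = -1, but the phases there are exp (-\<i> \<pi> \<nu>) and exp (\<i>
  \<pi> \<nu>), and their difference yields the sine term.\<close>

lemma circle_int_rec:
  "of_real \<nu> * circle_int R \<nu> = R * circle_int R (\<nu> - 1) + 2 * of_real (sin (pi * \<nu>)) * exp (- R)"
proof -
  define f where "f = (\<lambda>\<mu> \<theta>. exp (- (\<i> * of_real (\<mu> * \<theta>))) * exp (R * exp (\<i> * of_real \<theta>)))"
  have i: "integrable (lebesgue_on {-pi..pi}) (f \<mu>)" for \<mu>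
    unfolding f_def by (intro continuous_imp_integrable_real continuous_intros)
  have ce: "circle_int R \<mu> = (\<integral>\<theta>. f \<mu> \<theta> \<partial>lebesgue_on {-pi..pi})" for \<mu>
    by (simp add: circle_int_def f_def)
  have d: "(f \<nu> has_vector_derivative \<i> * (R * f (\<nu> - 1) \<theta> - of_real \<nu> * f \<nu> \<theta>)) (at \<theta> within S)" for \<theta> S
  proof -
    have "f (\<nu> - 1) \<theta> = exp (\<i> * of_real \<theta>) * f \<nu> \<theta>"
      unfolding f_def by (simp add: algebra_simps flip: exp_add)
    moreover have "((\<lambda>z. exp (- (\<i> * (of_real \<nu> * z))) * exp (R * exp (\<i> * z))) has_field_derivative
       \<i> * (R * exp (\<i> * z) - of_real \<nu>) * (exp (- (\<i> * (of_real \<nu> * z))) * exp (R * exp (\<i> * z)))) (at z)" for z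
      by (auto intro!: derivative_eq_intros simp: algebra_simps)
    note has_vector_derivative_real_field[OF this, of \<theta>]
    ultimately show ?thesis
      unfolding f_def by (auto intro!: has_vector_derivative_at_within simp: algebra_simps)
  qed
  have "(\<integral>\<theta>. \<i> * (R * f (\<nu> - 1) \<theta> - of_real \<nu> * f \<nu> \<theta>) \<partial>lebesgue_on {-pi..pi}) = f \<nu> pi - f \<nu> (- pi)"
  proof (subst lebesgue_integral_eq_integral)
    show "integral {-pi..pi} (\<lambda>\<theta>. \<i> * (R * f (\<nu> - 1) \<theta> - of_real \<nu> * f \<nu> \<theta>)) = f \<nu> pi - f \<nu> (- pi)"
      by (intro integral_unique fundamental_theorem_of_calculus d) auto
  qed (use i in auto)
  moreover have "(\<integral>\<theta>. \<i> * (R * f (\<nu> - 1) \<theta> - of_real \<nu> * f \<nu> \<theta>) \<partial>lebesgue_on {-pi..pi})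
      = \<i> * (R * circle_int R (\<nu> - 1) - of_real \<nu> * circle_int R \<nu>)"
    unfolding ce using i by simp
  moreover have "f \<nu> pi - f \<nu> (- pi) = - 2 * \<i> * of_real (sin (pi * \<nu>)) * exp (- R)"
  proof -
    have "f \<nu> pi - f \<nu> (- pi) = (exp (- (\<i> * of_real (pi * \<nu>))) - exp (\<i> * of_real (pi * \<nu>))) * exp (- R)"
      unfolding f_def by (simp add: exp_minus algebra_simps)
    also have "exp (- (\<i> * of_real (pi * \<nu>))) - exp (\<i> * of_real (pi * \<nu>)) = - 2 * \<i> * of_real (sin (pi * \<nu>))"
      by (simp only: sin_of_real[symmetric] sin_exp_eq) (simp add: field_simps)
    finally show ?thesis .
  qed
  ultimately have "\<i> * (R * circle_int R (\<nu> - 1) - of_real \<nu> * circle_int R \<nu>) = \<i> * (- 2 * of_real (sin (pi * \<nu>)) * exp (- R))"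
    by (simp add: mult_ac)
  then have "R * circle_int R (\<nu> - 1) - of_real \<nu> * circle_int R \<nu> = - 2 * of_real (sin (pi * \<nu>)) * exp (- R)"
    by (subst (asm) mult_cancel_left) auto
  then show ?thesis by (simp add: algebra_simps)
qed

text \<open>The same integration by parts along the ray; only the endpoint x = 0, that is u = -1,
  contributes.\<close>

lemma ray_int_rec:
  assumes R: "Re R > 0"
  shows "of_real \<nu> * ray_int R \<nu> = exp (- R) - R * ray_int R (\<nu> - 1)"
proof -
  define f where "f = (\<lambda>\<mu> x. exp (- of_real (\<mu> * x)) * exp (R * (- of_real (exp x))))"
  have i: "integrable (lebesgue_on {0..}) (f \<mu>)" for \<mu>
    unfolding f_def by (rule integrable_ray_int[OF R])
  have re: "ray_int R \<mu> = (\<integral>x. f \<mu> x \<partial>lebesgue_on {0..})" for \<mu>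
    by (simp add: ray_int_def f_def)
  have d: "(f \<nu> has_vector_derivative - R * f (\<nu> - 1) x - of_real \<nu> * f \<nu> x) (at x)" for x
  proof -
    have "f (\<nu> - 1) x = exp (of_real x) * f \<nu> x"
      unfolding f_def by (simp add: algebra_simps flip: exp_add)
    moreover have "((\<lambda>z. exp (- (of_real \<nu> * z)) * exp (R * (- exp z))) has_field_derivative
       (- R * exp z - of_real \<nu>) * (exp (- (of_real \<nu> * z)) * exp (R * (- exp z)))) (at z)" for z
      by (auto intro!: derivative_eq_intros simp: algebra_simps)
    note has_vector_derivative_real_field[OF this, of x]
    ultimately show ?thesis
      unfolding f_def by (auto simp: algebra_simps exp_of_real)
  qed
  have lim: "(f \<nu> \<longlongrightarrow> 0) at_top"
  proof (rule Lim_null_comparison)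
    show "\<forall>\<^sub>F x in at_top. norm (f \<nu> x) \<le> exp ((- \<nu>) * x - Re R / 2 * x ^ 2)"
      using eventually_ge_at_top[of 0]
    proof eventually_elim
      case (elim x)
      then show ?case
        using norm_ray_integrand_le[of "Re R" x \<nu>] R by (simp add: f_def norm_mult)
    qed
    show "((\<lambda>x. exp ((- \<nu>) * x - Re R / 2 * x ^ 2)) \<longlongrightarrow> 0) at_top"
      using R by real_asymp
  qed
  have "(\<integral>x. - R * f (\<nu> - 1) x - of_real \<nu> * f \<nu> x \<partial>lebesgue_on {0..}) = - f \<nu> 0"
    using d i lim by (intro integral_halfline_FTC) auto
  moreover have "f \<nu> 0 = exp (- R)" by (simp add: f_def)
  ultimately have "- R * ray_int R (\<nu> - 1) - of_real \<nu> * ray_int R \<nu> = - exp (- R)"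
    unfolding re using i by simp
  then show ?thesis by (simp add: algebra_simps)
qed

text \<open>The boundary terms of the circle and of the ray, both multiples of sin (\<pi> \<nu>) exp
  (-R), cancel.\<close>

lemma hankel_int_rec:
  assumes R: "Re R > 0"
  shows "of_real \<nu> * hankel_int R \<nu> = R * hankel_int R (\<nu> - 1)"
proof -
  have s: "sin (pi * (\<nu> - 1)) = - sin (pi * \<nu>)"
    by (simp add: right_diff_distrib sin_diff)
  have "of_real \<nu> * hankel_int R \<nu> = of_real \<nu> * circle_int R \<nu> / (2 * pi) - sin (pi * \<nu>) / pi * (of_real \<nu> * ray_int R \<nu>)"
    by (simp add: hankel_int_def algebra_simps)
  also have "\<dots> = R * hankel_int R (\<nu> - 1)"
    unfolding circle_int_rec ray_int_rec[OF R] hankel_int_def s by (simp add: field_simps)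
  finally show ?thesis .
qed

text \<open>The derivative formula and the recurrence combine to R H' = \<nu> H, so H R powr
  (-\<nu>) has zero derivative on the right half-plane. That half-plane is convex, hence the product
  is constant there.\<close>

lemma hankel_int_eq_powr:
  obtains c where "\<And>R. Re R > 0 \<Longrightarrow> hankel_int R \<nu> = c * R powr \<nu>"
proof -
  have "((\<lambda>w. hankel_int w \<nu> * w powr (- \<nu>)) has_field_derivative 0) (at R within {w. Re w > 0})"
    if "R \<in> {w. Re w > 0}" for R
  proof -
    have R: "Re R > 0" and R0: "R \<noteq> 0" using that by auto
    have nR: "R \<notin> \<real>\<^sub>\<le>\<^sub>0" using R by (auto simp: complex_nonpos_Reals_iff)
    have "((\<lambda>w. hankel_int w \<nu> * w powr (- \<nu>)) has_field_derivative
       hankel_int R (\<nu> - 1) * R powr (- \<nu>) + hankel_int R \<nu> * (- \<nu> * R powr (- \<nu> - 1))) (at R)"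
      using nR R0 by (auto intro!: derivative_eq_intros has_field_derivative_hankel_int R simp: powr_diff)
    also have "hankel_int R (\<nu> - 1) * R powr (- \<nu>) + hankel_int R \<nu> * (- \<nu> * R powr (- \<nu> - 1))
       = (R * hankel_int R (\<nu> - 1) - \<nu> * hankel_int R \<nu>) / R * R powr (- \<nu>)"
    proof -
      have e: "R powr (- \<nu> - 1) = R powr (- \<nu>) / R" using R0 by (simp add: powr_diff)
      define p where "p = R powr (- \<nu>)"
      define H H' where "H = hankel_int R \<nu>" and "H' = hankel_int R (\<nu> - 1)"
      show ?thesis unfolding e p_def[symmetric] H_def[symmetric] H'_def[symmetric]
        using R0 by (simp add: field_simps)
    qed
    also have "\<dots> = 0" by (simp add: hankel_int_rec[OF R])
    finally show ?thesis by (rule has_field_derivative_at_within)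
  qed
  then have "\<exists>c. \<forall>R\<in>{w. Re w > 0}. hankel_int R \<nu> * R powr (- \<nu>) = c"
    by (rule has_field_derivative_zero_constant[OF convex_halfspace_Re_gt])
  then obtain c where c: "\<And>R. Re R > 0 \<Longrightarrow> hankel_int R \<nu> * R powr (- \<nu>) = c"
    by blast
  have "hankel_int R \<nu> = c * R powr \<nu>" if "Re R > 0" for R
  proof -
    have "R \<noteq> 0" using that by auto
    then show ?thesis
      using c[of R] that by (simp add: powr_minus field_simps)
  qed
  then show ?thesis using that by blast
qed

section \<open>Identification of the constant in Hankel's integral\<close>

lemma circle_int_0_0: "circle_int 0 0 = 2 * pi"
  by (simp add: circle_int_def measure_restrict_space scaleR_conv_of_real)

text \<open>At order 0 the sine removes the ray, so the circle integral is constant on the right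
  half-plane. It is also continuous at R = 0, where its value is 2 \<pi>; the points 1 / (n + 1)
  connect the two facts.\<close>

lemma hankel_int_0:
  assumes R: "Re R > 0"
  shows "hankel_int R 0 = 1"
proof -
  obtain c where c: "\<And>R. Re R > 0 \<Longrightarrow> hankel_int R 0 = c * R powr (of_real 0)"
    using hankel_int_eq_powr[of 0] by blast
  have c': "circle_int R 0 / (2 * pi) = c" if "Re R > 0" for R
  proof -
    have "R \<noteq> 0" using that by auto
    then show ?thesis using c[OF that] by (simp add: hankel_int_def)
  qed
  have "isCont (\<lambda>w. circle_int w 0) 0"
    by (rule DERIV_isCont[OF has_field_derivative_circle_int])
  then have "((\<lambda>w. circle_int w 0) \<longlongrightarrow> circle_int 0 0) (at 0)"
    by (simp add: isCont_def)
  moreover have "filterlim (\<lambda>n. of_real (inverse (real (Suc n)))) (at (0::complex)) sequentially"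
  proof (rule filterlim_atI)
    have "(\<lambda>n. of_real (inverse (real (Suc n)))) \<longlonglongrightarrow> complex_of_real 0"
      by (intro tendsto_of_real LIMSEQ_inverse_real_of_nat)
    then show "(\<lambda>n. of_real (inverse (real (Suc n)))) \<longlonglongrightarrow> (0::complex)" by simp
  qed (simp del: of_nat_Suc)
  ultimately have "(\<lambda>n. circle_int (of_real (inverse (real (Suc n)))) 0 / (2 * pi)) \<longlonglongrightarrow> circle_int 0 0 / (2 * pi)"
    by (intro tendsto_divide tendsto_const) (auto intro: filterlim_compose)
  moreover have "(\<lambda>n. circle_int (of_real (inverse (real (Suc n)))) 0 / (2 * pi)) = (\<lambda>n. c)"
    by (rule ext, rule c') simp
  ultimately have "c = circle_int 0 0 / (2 * pi)"
    using LIMSEQ_unique tendsto_const by metis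
  then have "c = 1" by (simp add: circle_int_0_0)
  moreover have "R \<noteq> 0" using R by auto
  ultimately show ?thesis using c[OF R] by simp
qed

text \<open>The substitution s = r exp x turns the ray integral into an upper incomplete Gamma
  integral with parameter -\<nu>.\<close>

lemma ray_int_incomplete_Gamma:
  assumes r: "r > 0" and \<nu>: "\<nu> < 0"
  shows "ray_int (of_real r) \<nu> = of_real (r powr \<nu> * integral {r..} (\<lambda>s. s powr (- \<nu> - 1) / exp s))"
proof -
  define f where "f = (\<lambda>s::real. s powr (- \<nu> - 1) / exp s)"
  have "f absolutely_integrable_on {0..}"
    unfolding f_def using Gamma_integral_real[of "- \<nu>"] \<nu>
    by (intro nonnegative_absolutely_integrable_1) (auto simp: has_integral_integrable)
  then have fr: "f absolutely_integrable_on {r..}"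
    by (rule set_integrable_subset) (use r in auto)
  have im: "(\<lambda>x. r * exp x) ` {0..} = {r..}"
  proof (intro equalityI subsetI)
    fix y assume y: "y \<in> {r..}"
    show "y \<in> (\<lambda>x. r * exp x) ` {0..}"
      by (rule image_eqI[of _ _ "ln (y / r)"]) (use r y in auto)
  qed (use r in auto)
  have "(\<lambda>x. \<bar>r * exp x\<bar> * f (r * exp x)) absolutely_integrable_on {0..} \<and>
      integral {0..} (\<lambda>x. \<bar>r * exp x\<bar> * f (r * exp x)) = integral {r..} f"
  proof (rule has_absolute_integral_change_of_variables_1'
        [where g = "\<lambda>x. r * exp x" and g' = "\<lambda>x. r * exp x", THEN iffD2])
    show "inj_on (\<lambda>x. r * exp x) {0..}" using r by (auto simp: inj_on_def)
    show "((\<lambda>x. r * exp x) has_field_derivative r * exp x) (at x within {0..})" for x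
      by (auto intro!: derivative_eq_intros)
    show "f absolutely_integrable_on (\<lambda>x. r * exp x) ` {0..} \<and> integral ((\<lambda>x. r * exp x) ` {0..}) f = integral {r..} f"
      unfolding im using fr by simp
  qed auto
  moreover have eq: "\<bar>r * exp x\<bar> * f (r * exp x) = r powr (- \<nu>) * (exp (- (\<nu> * x)) * exp (r * - exp x))" for x
  proof -
    have "r * exp x * (r * exp x) powr (- \<nu> - 1) = (r * exp x) powr (- \<nu>)"
      using r by (simp add: powr_diff powr_mult)
    also have "\<dots> = r powr (- \<nu>) * exp (- (\<nu> * x))"
      using r by (simp add: powr_mult powr_def[of "exp x"])
    finally show ?thesis using r by (simp add: f_def exp_minus field_simps)
  qed
  ultimately have a: "(\<lambda>x. r powr (- \<nu>) * (exp (- (\<nu> * x)) * exp (r * - exp x))) absolutely_integrable_on {0..}"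
    and b: "integral {0..} (\<lambda>x. r powr (- \<nu>) * (exp (- (\<nu> * x)) * exp (r * - exp x))) = integral {r..} f"
    by (simp_all only: eq)
  have i: "integrable (lebesgue_on {0..}) (\<lambda>x. r powr (- \<nu>) * (exp (- (\<nu> * x)) * exp (r * - exp x)))"
    by (rule absolutely_integrable_imp_integrable[OF a]) simp
  have "of_real (r powr (- \<nu>)) * ray_int (of_real r) \<nu>
      = (\<integral>x. of_real (r powr (- \<nu>) * (exp (- (\<nu> * x)) * exp (r * - exp x))) \<partial>lebesgue_on {0..})"
    unfolding ray_int_def by (simp add: exp_of_real[symmetric])
  also have "\<dots> = of_real (\<integral>x. r powr (- \<nu>) * (exp (- (\<nu> * x)) * exp (r * - exp x)) \<partial>lebesgue_on {0..})"
    by (rule integral_of_real[OF i])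
  also have "(\<integral>x. r powr (- \<nu>) * (exp (- (\<nu> * x)) * exp (r * - exp x)) \<partial>lebesgue_on {0..}) = integral {r..} f"
    unfolding b[symmetric]
    by (rule lebesgue_integral_eq_integral[OF i]) simp
  finally have "of_real (r powr (- \<nu>)) * ray_int (of_real r) \<nu> = of_real (integral {r..} f)" .
  then have "of_real (r powr \<nu>) * (of_real (r powr (- \<nu>)) * ray_int (of_real r) \<nu>) = of_real (r powr \<nu> * integral {r..} f)"
    by simp
  moreover have "r powr \<nu> * r powr (- \<nu>) = 1" using r by (simp flip: powr_add)
  then have "complex_of_real (r powr \<nu>) * of_real (r powr (- \<nu>)) = 1"
    by (simp only: of_real_mult[symmetric] of_real_1)
  ultimately show ?thesis by (simp only: mult.assoc[symmetric] mult_1 f_def)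
qed

text \<open>The missing piece, the integral over {0..r}, is continuous in r and vanishes at r =
  0.\<close>

lemma tendsto_incomplete_Gamma:
  assumes z: "z > (0::real)"
  shows "((\<lambda>r. integral {r..} (\<lambda>s. s powr (z - 1) / exp s)) \<longlongrightarrow> Gamma z) (at_right 0)"
proof -
  define f where "f = (\<lambda>s::real. s powr (z - 1) / exp s)"
  have f: "(f has_integral Gamma z) {0..}" unfolding f_def by (rule Gamma_integral_real[OF z])
  have fa: "f absolutely_integrable_on {0..}"
    by (intro nonnegative_absolutely_integrable_1 has_integral_integrable[OF f]) (auto simp: f_def)
  have eq: "integral {r..} f = Gamma z - integral {0..r} f" if "r > 0" for r
  proof -
    have "f integrable_on {0..r}" "f integrable_on {r..}"
      using that by (auto intro!: set_lebesgue_integral_eq_integral(1) set_integrable_subset[OF fa])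
    then have "integral ({0..r} \<union> {r..}) f = integral {0..r} f + integral {r..} f"
      by (intro integral_Un) (auto simp: that ivl_disj_int intro: negligible_subset[of "{r}"])
    also have "{0..r} \<union> {r..} = {0..}" using that by auto
    finally show ?thesis using f by (simp add: integral_unique algebra_simps)
  qed
  have "f integrable_on {0..1}"
    by (auto intro!: set_lebesgue_integral_eq_integral(1) set_integrable_subset[OF fa])
  then have "continuous_on {0..1} (\<lambda>r. integral {0..r} f)"
    by (rule indefinite_integral_continuous_1)
  then have "((\<lambda>r. integral {0..r} f) \<longlongrightarrow> integral {0..0} f) (at 0 within {0..1})"
    unfolding continuous_on_def by (rule bspec) auto
  then have "((\<lambda>r. integral {0..r} f) \<longlongrightarrow> 0) (at_right 0)"
    by (simp add: at_within_Icc_at_right)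
  then have "((\<lambda>r. Gamma z - integral {0..r} f) \<longlongrightarrow> Gamma z - 0) (at_right 0)"
    by (intro tendsto_intros)
  moreover have "\<forall>\<^sub>F r in at_right 0. Gamma z - integral {0..r} f = integral {r..} f"
    using eventually_at_right_less[of 0] by eventually_elim (use eq in auto)
  ultimately show ?thesis unfolding f_def[symmetric] using tendsto_cong by fastforce
qed

lemma norm_circle_int_le:
  "norm (circle_int R \<nu>) \<le> 2 * pi * exp (norm R)"
proof -
  have "norm (circle_int R \<nu>) \<le> (\<integral>\<theta>. norm (exp (- (\<i> * of_real (\<nu> * \<theta>))) * exp (R * exp (\<i> * of_real \<theta>))) \<partial>lebesgue_on {-pi..pi})"
    unfolding circle_int_def by (rule integral_norm_bound)
  also have "\<dots> \<le> (\<integral>\<theta>. exp (norm R) \<partial>lebesgue_on {-pi..pi})"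
  proof (rule integral_mono)
    fix \<theta>
    have "Re (R * exp (\<i> * of_real \<theta>)) \<le> norm (R * exp (\<i> * of_real \<theta>))" by (rule complex_Re_le_cmod)
    then show "norm (exp (- (\<i> * of_real (\<nu> * \<theta>))) * exp (R * exp (\<i> * of_real \<theta>))) \<le> exp (norm R)"
      by (simp add: norm_mult)
  qed (intro continuous_imp_integrable_real continuous_intros)+
  also have "\<dots> = 2 * pi * exp (norm R)"
    by (simp add: measure_restrict_space)
  finally show ?thesis .
qed

lemma hankel_int_eq_base:
  assumes \<nu>: "-1 < \<nu>" "\<nu> < 0" and R: "Re R > 0"
  shows "hankel_int R \<nu> = R powr \<nu> * rGamma (of_real \<nu> + 1)"
proof -
  obtain c where c: "\<And>R. Re R > 0 \<Longrightarrow> hankel_int R \<nu> = c * R powr (of_real \<nu>)"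
    using hankel_int_eq_powr[of \<nu>] by blast
  define G where "G = (\<lambda>r. integral {r..} (\<lambda>s. s powr (- \<nu> - 1) / exp s))"
  \<comment> \<open>For r > 0 this is r powr (-\<nu>) times Hankel's integral, hence the constant
    \<open>c\<close>. As r tends to 0 its circle part vanishes because -\<nu> > 0, and its ray part
    tends to a complete Gamma value.\<close>
  define X where "X = (\<lambda>r. of_real (r powr (- \<nu>)) * circle_int (of_real r) \<nu> / (2 * pi) - of_real (sin (pi * \<nu>) / pi * G r))"
  have X: "X r = c" if r: "r > 0" for r
  proof -
    have "c = of_real (r powr (- \<nu>)) * (c * of_real r powr of_real \<nu>)"
      using r by (simp add: powr_of_real powr_minus)
    also have "c * of_real r powr of_real \<nu> = hankel_int (of_real r) \<nu>"
      using c[of "of_real r"] r by simp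
    also have "\<dots> = circle_int (of_real r) \<nu> / (2 * pi) - of_real (sin (pi * \<nu>) / pi) * of_real (r powr \<nu> * G r)"
      unfolding hankel_int_def ray_int_incomplete_Gamma[OF r \<nu>(2)] G_def by simp
    also have "of_real (r powr (- \<nu>)) * \<dots> = X r"
      using r by (simp add: X_def powr_minus algebra_simps)
    finally show ?thesis by simp
  qed
  have "((\<lambda>r. of_real (r powr (- \<nu>)) * circle_int (of_real r) \<nu> / (2 * pi)) \<longlongrightarrow> 0) (at_right 0)"
  proof (rule Lim_null_comparison)
    show "\<forall>\<^sub>F r in at_right 0. norm (of_real (r powr (- \<nu>)) * circle_int (of_real r) \<nu> / (2 * pi)) \<le> r powr (- \<nu>) * exp r"
      using eventually_at_right_less[of 0]
    proof eventually_elim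
      case (elim r)
      have "norm (of_real (r powr (- \<nu>)) * circle_int (of_real r) \<nu> / (2 * pi)) = r powr (- \<nu>) * (norm (circle_int (of_real r) \<nu>) / (2 * pi))"
        by (simp add: norm_mult norm_divide)
      also have "\<dots> \<le> r powr (- \<nu>) * exp r"
        using norm_circle_int_le[of "of_real r" \<nu>] elim by (intro mult_left_mono) (auto simp: field_simps)
      finally show ?case .
    qed
    show "((\<lambda>r. r powr (- \<nu>) * exp r) \<longlongrightarrow> 0) (at_right 0)"
      using \<nu> by real_asymp
  qed
  moreover have "(G \<longlongrightarrow> Gamma (- \<nu>)) (at_right 0)"
    unfolding G_def using tendsto_incomplete_Gamma[of "- \<nu>"] \<nu> by simp
  ultimately have "(X \<longlongrightarrow> 0 - of_real (sin (pi * \<nu>) / pi * Gamma (- \<nu>))) (at_right 0)"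
    unfolding X_def by (intro tendsto_intros)
  moreover have "(X \<longlongrightarrow> c) (at_right 0)"
    using eventually_at_right_less[of 0] by (intro tendsto_eventually) (auto elim: eventually_mono intro: X)
  ultimately have ceq: "c = - of_real (sin (pi * \<nu>) / pi * Gamma (- \<nu>))"
    using tendsto_unique by (metis diff_0 trivial_limit_at_right_real)
  \<comment> \<open>The reflection formula at -\<nu> converts the limit -sin (\<pi> \<nu>) Gamma
    (-\<nu>) / \<pi> into the reciprocal of Gamma (\<nu> + 1).\<close>
  have "rGamma (of_real (- \<nu>)) * rGamma (1 - of_real (- \<nu>)) = sin (of_real pi * of_real (- \<nu>)) / (of_real pi :: complex)"
    by (rule rGamma_reflection_complex)
  then have "rGamma (complex_of_real (- \<nu>)) * rGamma (complex_of_real \<nu> + 1) = - of_real (sin (pi * \<nu>) / pi)"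
    by (simp only: of_real_mult[symmetric] sin_of_real) (simp add: add.commute)
  moreover have "Gamma (complex_of_real (- \<nu>)) * rGamma (complex_of_real (- \<nu>)) = 1"
  proof -
    have "complex_of_real (- \<nu>) \<notin> \<int>\<^sub>\<le>\<^sub>0" using \<nu>
      by (metis add_le_same_cancel1 neg_0_less_iff_less of_real_in_nonpos_Ints_iff nonpos_Ints_nonpos not_less)
    then show ?thesis by (simp add: Gamma_def rGamma_eq_zero_iff)
  qed
  ultimately have "rGamma (complex_of_real \<nu> + 1) = - of_real (sin (pi * \<nu>) / pi) * Gamma (complex_of_real (- \<nu>))"
    by (metis mult.assoc mult.commute mult_1)
  also have "\<dots> = c"
    unfolding ceq Gamma_complex_of_real by simp
  finally show ?thesis using c[OF R] by (simp add: mult.commute)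
qed

theorem hankel_int_eq:
  assumes R: "Re R > 0"
  shows "hankel_int R \<nu> = R powr \<nu> * rGamma (of_real \<nu> + 1)"
proof -
  have R0: "R \<noteq> 0" using R by auto
  let ?P = "\<lambda>\<mu>::real. hankel_int R \<mu> = R powr (of_real \<mu>) * rGamma (of_real \<mu> + 1)"
  have base: "?P \<mu>" if "-1 < \<mu>" "\<mu> \<le> 0" for \<mu>
    using that hankel_int_eq_base[OF _ _ R, of \<mu>] hankel_int_0[OF R] R0 by (cases "\<mu> = 0") auto
  have step: "of_real \<mu> * (R powr (of_real \<mu>) * rGamma (of_real \<mu> + 1)) = R * (R powr (of_real (\<mu> - 1)) * rGamma (of_real (\<mu> - 1) + 1))" for \<mu>
    using R0 rGamma_plus1[of "complex_of_real \<mu>"] by (simp add: powr_diff)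
  \<comment> \<open>Going up divides by \<mu>, which fails only at order 0; that order is supplied
    by \<open>base\<close>. Going down divides by \<open>R\<close> instead.\<close>
  have up: "?P \<mu>" if "?P (\<mu> - 1)" for \<mu>
  proof (cases "\<mu> = 0")
    case False
    have "of_real \<mu> * hankel_int R \<mu> = of_real \<mu> * (R powr (of_real \<mu>) * rGamma (of_real \<mu> + 1))"
      unfolding step hankel_int_rec[OF R, of \<mu>] that ..
    then show ?thesis using False by simp
  qed (use base in auto)
  have down: "?P (\<mu> - 1)" if "?P \<mu>" for \<mu>
    using hankel_int_rec[OF R, of \<mu>] step[of \<mu>] that R0 by auto
  \<comment> \<open>Subtracting the ceiling places the order in the half-open interval covered by
    \<open>base\<close>.\<close>
  define \<mu> where "\<mu> = \<nu> - of_int \<lceil>\<nu>\<rceil>"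
  have \<mu>: "-1 < \<mu>" "\<mu> \<le> 0" unfolding \<mu>_def by linarith+
  have P0: "?P \<mu>" by (rule base[OF \<mu>])
  have "?P (\<mu> + of_int m)" for m
  proof (induction m rule: int_induct[where k = 0])
    case base
    then show ?case using P0 by simp
  next
    case (step1 i)
    then show ?case using up[of "\<mu> + of_int (i + 1)"] by (simp add: algebra_simps)
  next
    case (step2 i)
    then show ?case using down[of "\<mu> + of_int i"] by (simp add: algebra_simps)
  qed
  from this[of "\<lceil>\<nu>\<rceil>"] show ?thesis by (simp add: \<mu>_def)
qed

section \<open>Integral for the Bessel function of the first kind\<close>

definition sinh_ray_int :: "complex \<Rightarrow> real \<Rightarrow> complex" where
  "sinh_ray_int t \<nu> =
     (\<integral>x. exp (- t * of_real (sinh x)) * exp (of_real (\<nu> * x)) \<partial>lebesgue_on {0..})"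

text \<open>Each coefficient R powr (\<nu> + k) / Gamma (\<nu> + k + 1) is replaced by Hankel's
  integral of order \<nu> + k. Summing under the integral produces exp (R (u - 1/u)), whose exponent
  is \<i> t sin \<theta> on the circle and -t sinh x on the ray u = -exp x.\<close>

theorem bessel_J_integral:
  assumes t: "Re t > 0"
  shows "bessel_J \<nu> t =
    (\<integral>\<theta>. exp (\<i> * (t * of_real (sin \<theta>) - of_real (\<nu> * \<theta>))) \<partial>lebesgue_on {-pi..pi}) / (2 * pi)
    - sin (pi * \<nu>) / pi * sinh_ray_int t (- \<nu>)"
proof -
  define R where "R = t / 2"
  have R: "Re R > 0" and R0: "R \<noteq> 0" using t by (auto simp: R_def)
  \<comment> \<open>This alternating sign cancels the one in (-R)^k, so the ray series below runs
    over R^k.\<close>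
  have sin_shift: "sin (pi * (\<nu> + real k)) = (-1) ^ k * sin (pi * \<nu>)" for k
    by (simp add: distrib_left sin_add mult.commute[of pi "real k"])
  have circ: "(\<lambda>k. (- R) ^ k / fact k * circle_int R (\<nu> + real k)) sums
      (\<integral>\<theta>. exp (\<i> * (t * of_real (sin \<theta>) - of_real (\<nu> * \<theta>))) \<partial>lebesgue_on {-pi..pi})"
  proof -
    define g where "g = (\<lambda>\<theta>. exp (- (\<i> * of_real (\<nu> * \<theta>))) * exp (R * exp (\<i> * of_real \<theta>)))"
    have "(\<lambda>k. (- R) ^ k / fact k * (\<integral>\<theta>. g \<theta> * exp (- (\<i> * of_real \<theta>)) ^ k \<partial>lebesgue_on {-pi..pi}))
        sums (\<integral>\<theta>. g \<theta> * exp (- R * exp (- (\<i> * of_real \<theta>))) \<partial>lebesgue_on {-pi..pi})"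
      unfolding g_def
      by (intro sums_integral_exp continuous_imp_integrable_real continuous_measurable_lebesgue_on continuous_intros) auto
    moreover have "(\<integral>\<theta>. g \<theta> * exp (- (\<i> * of_real \<theta>)) ^ k \<partial>lebesgue_on {-pi..pi}) = circle_int R (\<nu> + real k)" for k
      unfolding circle_int_def g_def
      by (intro Bochner_Integration.integral_cong refl) (simp add: algebra_simps flip: exp_add exp_of_nat_mult)
    moreover have "g \<theta> * exp (- R * exp (- (\<i> * of_real \<theta>))) = exp (\<i> * (t * of_real (sin \<theta>) - of_real (\<nu> * \<theta>)))" for \<theta>
    proof -
      have "\<i> * (t * of_real (sin \<theta>) - of_real (\<nu> * \<theta>))
          = - (\<i> * of_real (\<nu> * \<theta>)) + R * exp (\<i> * of_real \<theta>) - R * exp (- (\<i> * of_real \<theta>))"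
        by (simp only: sin_of_real[symmetric] sin_exp_eq R_def) (simp add: field_simps)
      then show ?thesis by (simp only: g_def) (simp add: algebra_simps flip: exp_add)
    qed
    ultimately show ?thesis by simp
  qed
  have ray: "(\<lambda>k. R ^ k / fact k * ray_int R (\<nu> + real k)) sums sinh_ray_int t (- \<nu>)"
  proof -
    define g where "g = (\<lambda>x. exp (- of_real (\<nu> * x)) * exp (R * (- of_real (exp x))))"
    have "(\<lambda>k. R ^ k / fact k * (\<integral>x. g x * of_real (exp (- x)) ^ k \<partial>lebesgue_on {0..}))
        sums (\<integral>x. g x * exp (R * of_real (exp (- x))) \<partial>lebesgue_on {0..})"
      unfolding g_def
      by (intro sums_integral_exp integrable_ray_int R continuous_measurable_lebesgue_on continuous_intros) auto
    moreover have "(\<integral>x. g x * of_real (exp (- x)) ^ k \<partial>lebesgue_on {0..}) = ray_int R (\<nu> + real k)" for k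
      unfolding ray_int_def g_def exp_of_real[symmetric]
      by (intro Bochner_Integration.integral_cong refl) (simp add: algebra_simps flip: exp_add exp_of_nat_mult)
    moreover have "g x * exp (R * of_real (exp (- x))) = exp (- t * of_real (sinh x)) * exp (of_real (- \<nu> * x))" for x
    proof -
      have "- t * of_real (sinh x) = R * of_real (exp (- x)) - R * of_real (exp x)"
        by (simp add: sinh_field_def R_def field_simps)
      then show ?thesis by (simp add: g_def algebra_simps flip: exp_add)
    qed
    ultimately show ?thesis by (simp add: sinh_ray_int_def)
  qed
  have "(\<lambda>k. (- R) ^ k / fact k * circle_int R (\<nu> + real k) / (2 * pi)
            - sin (pi * \<nu>) / pi * (R ^ k / fact k * ray_int R (\<nu> + real k))) sums
     ((\<integral>\<theta>. exp (\<i> * (t * of_real (sin \<theta>) - of_real (\<nu> * \<theta>))) \<partial>lebesgue_on {-pi..pi}) / (2 * pi)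
       - sin (pi * \<nu>) / pi * sinh_ray_int t (- \<nu>))"
    by (intro sums_diff sums_divide sums_mult circ ray)
  also have "(\<lambda>k. (- R) ^ k / fact k * circle_int R (\<nu> + real k) / (2 * pi)
            - sin (pi * \<nu>) / pi * (R ^ k / fact k * ray_int R (\<nu> + real k)))
      = (\<lambda>k. (- R) ^ k / fact k * hankel_int R (\<nu> + real k))"
  proof
    fix k
    have "(- R) ^ k * (-1) ^ k = R ^ k" by (simp flip: power_mult_distrib)
    then have e: "R ^ k = (- R) ^ k * (-1) ^ k" by simp
    show "(- R) ^ k / fact k * circle_int R (\<nu> + real k) / (2 * pi)
            - sin (pi * \<nu>) / pi * (R ^ k / fact k * ray_int R (\<nu> + real k))
        = (- R) ^ k / fact k * hankel_int R (\<nu> + real k)"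
      by (simp only: hankel_int_def sin_shift e) (simp add: algebra_simps)
  qed
  also have "\<dots> = (\<lambda>k. R powr \<nu> * ((-1) ^ k * R ^ (2 * k) / fact k * rGamma (of_real \<nu> + of_nat k + 1)))"
  proof
    fix k
    have "R powr (of_real (\<nu> + real k)) = R powr \<nu> * R ^ k"
      using R0 by (simp add: powr_add powr_nat')
    moreover have "(- R) ^ k * R ^ k = (-1) ^ k * R ^ (2 * k)"
      by (subst power_minus) (simp add: mult_2 power_add)
    ultimately show "(- R) ^ k / fact k * hankel_int R (\<nu> + real k)
        = R powr \<nu> * ((-1) ^ k * R ^ (2 * k) / fact k * rGamma (of_real \<nu> + of_nat k + 1))"
      unfolding hankel_int_eq[OF R] by (simp add: field_simps)
  qed
  finally have s: "(\<lambda>k. R powr \<nu> * ((-1) ^ k * R ^ (2 * k) / fact k * rGamma (of_real \<nu> + of_nat k + 1))) sums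
     ((\<integral>\<theta>. exp (\<i> * (t * of_real (sin \<theta>) - of_real (\<nu> * \<theta>))) \<partial>lebesgue_on {-pi..pi}) / (2 * pi)
       - sin (pi * \<nu>) / pi * sinh_ray_int t (- \<nu>))" (is "_ sums ?S") .
  \<comment> \<open>Dividing by the nonzero power transfers summability to the bare series in
    \<open>bessel_J\<close>, so that the factor may be pulled out of \<open>suminf\<close>.\<close>
  have "R powr \<nu> \<noteq> 0" using R0 by simp
  then have "summable (\<lambda>k. (-1) ^ k * R ^ (2 * k) / fact k * rGamma (of_real \<nu> + of_nat k + 1))"
    by (intro summable_mult_D[OF sums_summable[OF s]])
  then have "R powr \<nu> * (\<Sum>k. (-1) ^ k * R ^ (2 * k) / fact k * rGamma (of_real \<nu> + of_nat k + 1)) = ?S"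
    by (subst suminf_mult[symmetric]) (simp_all only: sums_unique[OF s])
  then show ?thesis by (simp add: bessel_J_def R_def)
qed

section \<open>Derivatives of exponential integrals in the order\<close>

text \<open>Formally the n-th derivative in \<nu> of the integral of g exp (\<nu> b): each
  differentiation brings down one factor b.\<close>

definition exp_moment ::
  "'a measure \<Rightarrow> ('a \<Rightarrow> complex) \<Rightarrow> ('a \<Rightarrow> complex) \<Rightarrow> nat \<Rightarrow> real \<Rightarrow> complex" where
  "exp_moment M g b n \<nu> = (\<integral>x. g x * b x ^ n * exp (of_real \<nu> * b x) \<partial>M)"

text \<open>Every rate \<open>c\<close> is demanded, so that a single condition serves all n and all
  \<nu>.\<close>

definition exp_dominated :: "'a measure \<Rightarrow> ('a \<Rightarrow> complex) \<Rightarrow> ('a \<Rightarrow> complex) \<Rightarrow> bool" where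
  "exp_dominated M g b \<longleftrightarrow> g \<in> borel_measurable M \<and> b \<in> borel_measurable M \<and>
     (\<forall>c. integrable M (\<lambda>x. norm (g x) * exp (c * norm (b x))))"

text \<open>All factors depending on b fit under exp ((n + |\<nu>| + 1) |b|), because |b| \<le> exp
  |b|. The second claim is the domination condition of
  \<open>has_field_derivative_exp_integral\<close> with d = 1.\<close>

lemma exp_dominated_integrable:
  assumes "exp_dominated M g b"
  shows "integrable M (\<lambda>x. g x * b x ^ n * exp (of_real \<nu> * b x))"
    and "integrable M (\<lambda>x. norm (g x * b x ^ n) * exp (Re (of_real \<nu> * b x)) * exp (1 * norm (b x)))"
proof -
  have [measurable]: "g \<in> borel_measurable M" "b \<in> borel_measurable M"
    and i: "\<And>c. integrable M (\<lambda>x. norm (g x) * exp (c * norm (b x)))"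
    using assms by (auto simp: exp_dominated_def)
  have le: "norm (b x) ^ n * exp (Re (of_real \<nu> * b x)) * exp (norm (b x)) \<le> exp ((real n + \<bar>\<nu>\<bar> + 1) * norm (b x))" for x
  proof -
    have "norm (b x) \<le> exp (norm (b x))" using exp_ge_add_one_self[of "norm (b x)"] by linarith
    then have 1: "norm (b x) ^ n \<le> exp (real n * norm (b x))"
      using power_mono[of "norm (b x)" "exp (norm (b x))" n] by (simp add: exp_of_nat_mult)
    have "Re (of_real \<nu> * b x) \<le> norm (of_real \<nu> * b x)" by (rule complex_Re_le_cmod)
    then have 2: "exp (Re (of_real \<nu> * b x)) \<le> exp (\<bar>\<nu>\<bar> * norm (b x))"
      by (simp add: norm_mult)
    have "norm (b x) ^ n * exp (Re (of_real \<nu> * b x)) * exp (norm (b x))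
        \<le> exp (real n * norm (b x)) * exp (\<bar>\<nu>\<bar> * norm (b x)) * exp (norm (b x))"
      by (intro mult_mono 1 2) auto
    also have "\<dots> = exp ((real n + \<bar>\<nu>\<bar> + 1) * norm (b x))"
      by (simp add: algebra_simps flip: exp_add)
    finally show ?thesis .
  qed
  show 2: "integrable M (\<lambda>x. norm (g x * b x ^ n) * exp (Re (of_real \<nu> * b x)) * exp (1 * norm (b x)))"
  proof (rule Bochner_Integration.integrable_bound[OF i[of "real n + \<bar>\<nu>\<bar> + 1"]], measurable, intro AE_I2)
    fix x
    show "norm (norm (g x * b x ^ n) * exp (Re (of_real \<nu> * b x)) * exp (1 * norm (b x)))
        \<le> norm (norm (g x) * exp ((real n + \<bar>\<nu>\<bar> + 1) * norm (b x)))"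
      using mult_left_mono[OF le[of x] norm_ge_zero[of "g x"]]
      by (simp add: norm_mult norm_power mult.assoc)
  qed
  show "integrable M (\<lambda>x. g x * b x ^ n * exp (of_real \<nu> * b x))"
  proof (rule Bochner_Integration.integrable_bound[OF 2], measurable, intro AE_I2)
    fix x
    have "norm (g x * b x ^ n) * exp (Re (of_real \<nu> * b x)) * 1
        \<le> norm (g x * b x ^ n) * exp (Re (of_real \<nu> * b x)) * exp (1 * norm (b x))"
      by (intro mult_left_mono) auto
    then show "norm (g x * b x ^ n * exp (of_real \<nu> * b x))
        \<le> norm (norm (g x * b x ^ n) * exp (Re (of_real \<nu> * b x)) * exp (1 * norm (b x)))"
      by (simp add: norm_mult)
  qed
qed

lemma has_vector_derivative_exp_moment:
  assumes d: "exp_dominated M g b"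
  shows "(exp_moment M g b n has_vector_derivative exp_moment M g b (Suc n) \<nu>) (at \<nu>)"
proof -
  have [measurable]: "g \<in> borel_measurable M" "b \<in> borel_measurable M"
    using d by (auto simp: exp_dominated_def)
  have "((\<lambda>w. \<integral>x. g x * b x ^ n * exp (w * b x) \<partial>M) has_field_derivative
      (\<integral>x. g x * b x ^ n * b x * exp (of_real \<nu> * b x) \<partial>M)) (at (of_real \<nu>))"
    by (rule has_field_derivative_exp_integral[where d = 1]) (use exp_dominated_integrable(2)[OF d] in auto)
  from has_vector_derivative_real_field[OF this]
  show ?thesis by (simp add: exp_moment_def[abs_def] mult_ac)
qed

lemma exp_dominated_interval:
  fixes a b :: real
  assumes "continuous_on {a..b} g" "continuous_on {a..b} f"
  shows "exp_dominated (lebesgue_on {a..b}) g f"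
  unfolding exp_dominated_def
proof (intro conjI allI)
  show "g \<in> borel_measurable (lebesgue_on {a..b})"
    by (rule continuous_measurable_lebesgue_on) (use assms in auto)
  show "f \<in> borel_measurable (lebesgue_on {a..b})"
    by (rule continuous_measurable_lebesgue_on) (use assms in auto)
  show "integrable (lebesgue_on {a..b}) (\<lambda>x. norm (g x) * exp (c * norm (f x)))" for c
    by (intro continuous_imp_integrable_real continuous_intros assms)
qed

lemma exp_dominated_sinh:
  assumes t: "Re t > 0" and f: "continuous_on {0..} f" and fle: "\<And>x. x \<ge> 0 \<Longrightarrow> norm (f x) \<le> B + x"
  shows "exp_dominated (lebesgue_on {0..}) (\<lambda>x. exp (- t * of_real (sinh x))) f"
  unfolding exp_dominated_def
proof (intro conjI allI)
  show "(\<lambda>x. exp (- t * of_real (sinh x))) \<in> borel_measurable (lebesgue_on {0..})"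
    by (intro continuous_measurable_lebesgue_on continuous_intros) auto
  show "f \<in> borel_measurable (lebesgue_on {0..})"
    by (intro continuous_measurable_lebesgue_on f) auto
  fix c :: real
  \<comment> \<open>Dividing by exp (|c| B) removes the constant term of the exponent, which the
    quadratic criterion does not allow; the factor is restored afterwards.\<close>
  have "integrable (lebesgue_on {0..}) (\<lambda>x. norm (exp (- t * of_real (sinh x))) * exp (c * norm (f x)) / exp (\<bar>c\<bar> * B))"
  proof (intro integrable_halfline_quadratic[where q = "Re t / 4" and c = "\<bar>c\<bar>"] continuous_intros f)
    fix x :: real assume x: "x \<ge> 0"
    have "Re t * (x ^ 2 / 4) \<le> Re t * sinh x"
      using t by (intro mult_left_mono sinh_ge_quarter_square x) auto
    moreover have "c * norm (f x) \<le> \<bar>c\<bar> * norm (f x)"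
      by (intro mult_right_mono) auto
    moreover have "\<bar>c\<bar> * norm (f x) \<le> \<bar>c\<bar> * (B + x)"
      by (intro mult_left_mono fle x) auto
    ultimately have "- (Re t * sinh x) + c * norm (f x) - \<bar>c\<bar> * B \<le> \<bar>c\<bar> * x - Re t / 4 * x ^ 2"
      by (simp add: algebra_simps)
    then have "exp (- (Re t * sinh x) + c * norm (f x) - \<bar>c\<bar> * B) \<le> exp (\<bar>c\<bar> * x - Re t / 4 * x ^ 2)"
      by simp
    then show "norm (norm (exp (- t * of_real (sinh x))) * exp (c * norm (f x)) / exp (\<bar>c\<bar> * B))
        \<le> exp (\<bar>c\<bar> * x - Re t / 4 * x ^ 2)"
      by (simp only: exp_add exp_diff) simp
  qed (use t in auto)
  from integrable_mult_right[OF this, of "exp (\<bar>c\<bar> * B)"]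
  show "integrable (lebesgue_on {0..}) (\<lambda>x. norm (exp (- t * of_real (sinh x))) * exp (c * norm (f x)))"
    by simp
qed

section \<open>Reflection and folding of integrals over intervals\<close>

lemma integral_reflect_pi:
  fixes h :: "real \<Rightarrow> complex"
  assumes h: "continuous_on UNIV h"
  shows "(\<integral>x. h (pi - x) \<partial>lebesgue_on {0..pi}) = (\<integral>x. h x \<partial>lebesgue_on {0..pi})"
proof -
  have c: "continuous_on S (\<lambda>x. h (k x))" if "continuous_on S k" for S :: "real set" and k
    using continuous_on_compose2[OF h that] by auto
  have "(\<integral>x. h (pi - x) \<partial>lebesgue_on {0..pi}) = integral {0..pi} (\<lambda>x. h (pi - x))"
    by (intro lebesgue_integral_eq_integral continuous_imp_integrable_real c continuous_intros) auto
  also have "\<dots> = integral {0..pi} ((\<lambda>x. h (- x)) \<circ> (\<lambda>x. x + - pi))"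
    by (simp add: o_def)
  also have "\<dots> = integral {0 + - pi..pi + - pi} (\<lambda>x. h (- x))"
    by (intro integral_shift c continuous_intros)
  also have "\<dots> = integral {0..pi} h"
    using Henstock_Kurzweil_Integration.integral_reflect_real[of pi 0 h] by simp
  also have "\<dots> = (\<integral>x. h x \<partial>lebesgue_on {0..pi})"
    by (intro lebesgue_integral_eq_integral[symmetric] continuous_imp_integrable_real continuous_on_subset[OF h]) auto
  finally show ?thesis .
qed

lemma integral_split_symmetric:
  fixes h :: "real \<Rightarrow> complex"
  assumes h: "continuous_on UNIV h" and a: "a \<ge> 0"
  shows "(\<integral>x. h x \<partial>lebesgue_on {-a..a}) = (\<integral>x. h x \<partial>lebesgue_on {0..a}) + (\<integral>x. h (- x) \<partial>lebesgue_on {0..a})"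
proof -
  have c: "continuous_on S (\<lambda>x. h (k x))" if "continuous_on S k" for S :: "real set" and k
    using continuous_on_compose2[OF h that] by auto
  have "(\<integral>x. h x \<partial>lebesgue_on {-a..a}) = integral {-a..a} h"
    by (intro lebesgue_integral_eq_integral continuous_imp_integrable_real continuous_on_subset[OF h]) auto
  also have "\<dots> = integral {-a..0} h + integral {0..a} h"
    by (intro Henstock_Kurzweil_Integration.integral_combine[symmetric] integrable_continuous_interval continuous_on_subset[OF h]) (use a in auto)
  also have "integral {-a..0} h = integral {0..a} (\<lambda>x. h (- x))"
    using Henstock_Kurzweil_Integration.integral_reflect_real[of a 0 "\<lambda>x. h (- x)"] by simp
  also have "\<dots> = (\<integral>x. h (- x) \<partial>lebesgue_on {0..a})"
    by (intro lebesgue_integral_eq_integral[symmetric] continuous_imp_integrable_real c continuous_intros) auto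
  also have "integral {0..a} h = (\<integral>x. h x \<partial>lebesgue_on {0..a})"
    by (intro lebesgue_integral_eq_integral[symmetric] continuous_imp_integrable_real continuous_on_subset[OF h]) auto
  finally show ?thesis by simp
qed

section \<open>The Bessel function of the second kind\<close>

text \<open>For s = \<i> and s = -\<i> the case n = 0 integrates exp (s (t sin x - \<nu> x)), the
  two exponentials that make up the sine in the theorem.\<close>

definition arc_moment :: "complex \<Rightarrow> complex \<Rightarrow> nat \<Rightarrow> real \<Rightarrow> complex" where
  "arc_moment t s =
     exp_moment (lebesgue_on {0..pi}) (\<lambda>x. exp (s * t * of_real (sin x))) (\<lambda>x. - s * of_real x)"

definition ray_moment :: "complex \<Rightarrow> (real \<Rightarrow> complex) \<Rightarrow> nat \<Rightarrow> real \<Rightarrow> complex" where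
  "ray_moment t f = exp_moment (lebesgue_on {0..}) (\<lambda>x. exp (- t * of_real (sinh x))) f"

text \<open>The right-hand side of the theorem with the sine and the real part written through
  exponentials. All dependence on \<nu> then sits in exponential moments, so passing from n to n + 1
  is differentiation.\<close>

definition Y_deriv :: "complex \<Rightarrow> nat \<Rightarrow> real \<Rightarrow> complex" where
  "Y_deriv t n \<nu> =
     (arc_moment t \<i> n \<nu> - arc_moment t (- \<i>) n \<nu>) / (2 * \<i> * pi)
     - (ray_moment t of_real n \<nu>
        + (ray_moment t (\<lambda>x. \<i> * pi - of_real x) n \<nu> + ray_moment t (\<lambda>x. - \<i> * pi - of_real x) n \<nu>) / 2) / pi"

lemma exp_dominated_arc:
  "exp_dominated (lebesgue_on {0..pi}) (\<lambda>x. exp (s * t * of_real (sin x))) (\<lambda>x. - s * of_real x)"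
  by (intro exp_dominated_interval continuous_intros)

lemma exp_dominated_ray:
  assumes "Re t > 0"
  shows "exp_dominated (lebesgue_on {0..}) (\<lambda>x. exp (- t * of_real (sinh x))) of_real"
    and "exp_dominated (lebesgue_on {0..}) (\<lambda>x. exp (- t * of_real (sinh x))) (\<lambda>x. \<i> * pi - of_real x)"
    and "exp_dominated (lebesgue_on {0..}) (\<lambda>x. exp (- t * of_real (sinh x))) (\<lambda>x. - \<i> * pi - of_real x)"
proof -
  have n: "norm (c * complex_of_real pi - of_real x) \<le> pi + x" if "norm c = 1" "x \<ge> 0" for x c
    using norm_triangle_ineq4[of "c * complex_of_real pi" "of_real x"] that by (simp add: norm_mult)
  show "exp_dominated (lebesgue_on {0..}) (\<lambda>x. exp (- t * of_real (sinh x))) of_real"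
    by (rule exp_dominated_sinh[OF assms, where B = 0]) (auto intro!: continuous_intros)
  show "exp_dominated (lebesgue_on {0..}) (\<lambda>x. exp (- t * of_real (sinh x))) (\<lambda>x. \<i> * pi - of_real x)"
    by (rule exp_dominated_sinh[OF assms, where B = pi]) (use n in \<open>auto intro!: continuous_intros\<close>)
  show "exp_dominated (lebesgue_on {0..}) (\<lambda>x. exp (- t * of_real (sinh x))) (\<lambda>x. - \<i> * pi - of_real x)"
    by (rule exp_dominated_sinh[OF assms, where B = pi]) (use n[of "- \<i>"] in \<open>auto intro!: continuous_intros\<close>)
qed

lemma has_vector_derivative_Y_deriv:
  assumes "Re t > 0"
  shows "(Y_deriv t n has_vector_derivative Y_deriv t (Suc n) \<nu>) (at \<nu>)"
  unfolding Y_deriv_def[abs_def] arc_moment_def ray_moment_def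
  by (intro has_vector_derivative_diff has_vector_derivative_add has_vector_derivative_divide
      has_vector_derivative_exp_moment exp_dominated_arc exp_dominated_ray assms)

lemma bessel_J_moments:
  assumes t: "Re t > 0"
  shows "bessel_J \<nu> t = (arc_moment t \<i> 0 \<nu> + arc_moment t (- \<i>) 0 \<nu>) / (2 * pi)
           - sin (pi * \<nu>) / pi * ray_moment t of_real 0 (- \<nu>)"
proof -
  define h where "h = (\<lambda>\<theta>. exp (\<i> * (t * of_real (sin \<theta>) - of_real (\<nu> * \<theta>))))"
  have "(\<integral>\<theta>. h \<theta> \<partial>lebesgue_on {-pi..pi}) = (\<integral>\<theta>. h \<theta> \<partial>lebesgue_on {0..pi}) + (\<integral>\<theta>. h (- \<theta>) \<partial>lebesgue_on {0..pi})"
    unfolding h_def by (intro integral_split_symmetric continuous_intros) auto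
  also have "(\<integral>\<theta>. h \<theta> \<partial>lebesgue_on {0..pi}) = arc_moment t \<i> 0 \<nu>"
    unfolding arc_moment_def exp_moment_def h_def
    by (intro Bochner_Integration.integral_cong refl) (simp add: algebra_simps flip: exp_add)
  also have "(\<integral>\<theta>. h (- \<theta>) \<partial>lebesgue_on {0..pi}) = arc_moment t (- \<i>) 0 \<nu>"
    unfolding arc_moment_def exp_moment_def h_def
    by (intro Bochner_Integration.integral_cong refl) (simp add: algebra_simps flip: exp_add)
  finally show ?thesis
    unfolding bessel_J_integral[OF t] h_def
    by (simp add: sinh_ray_int_def ray_moment_def exp_moment_def)
qed

text \<open>The substitution x -> \<pi> - x preserves sin x and exchanges the signs of the order up
  to a phase. Thus J of order -\<nu> uses the same two arc integrals as J of order \<nu>.\<close>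

lemma arc_moment_reflect:
  "arc_moment t s 0 (- \<nu>) = exp (s * of_real (pi * \<nu>)) * arc_moment t s 0 \<nu>"
proof -
  define h where "h = (\<lambda>x. exp (s * t * of_real (sin x)) * exp (of_real (- \<nu>) * (- s * of_real x)))"
  have "arc_moment t s 0 (- \<nu>) = (\<integral>x. h x \<partial>lebesgue_on {0..pi})"
    by (simp add: arc_moment_def exp_moment_def h_def)
  also have "\<dots> = (\<integral>x. h (pi - x) \<partial>lebesgue_on {0..pi})"
    unfolding h_def by (intro integral_reflect_pi[symmetric] continuous_intros)
  also have "\<dots> = (\<integral>x. exp (s * of_real (pi * \<nu>)) * (exp (s * t * of_real (sin x)) * exp (of_real \<nu> * (- s * of_real x))) \<partial>lebesgue_on {0..pi})"
    unfolding h_def by (intro Bochner_Integration.integral_cong refl) (simp add: algebra_simps flip: exp_add)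
  also have "\<dots> = exp (s * of_real (pi * \<nu>)) * arc_moment t s 0 \<nu>"
    by (simp add: arc_moment_def exp_moment_def)
  finally show ?thesis .
qed

lemma ray_moment_shift:
  "ray_moment t (\<lambda>x. c - of_real x) 0 \<nu> = exp (of_real \<nu> * c) * ray_moment t of_real 0 (- \<nu>)"
proof -
  have "ray_moment t (\<lambda>x. c - of_real x) 0 \<nu> =
    (\<integral>x. exp (of_real \<nu> * c) * (exp (- t * of_real (sinh x)) * exp (of_real (- \<nu>) * of_real x)) \<partial>lebesgue_on {0..})"
    unfolding ray_moment_def exp_moment_def
    by (intro Bochner_Integration.integral_cong refl) (simp add: algebra_simps flip: exp_add)
  then show ?thesis by (simp add: ray_moment_def exp_moment_def)
qed

text \<open>With \<open>E\<close> and \<open>E'\<close> the exponentials of \<i> \<pi> \<nu> and its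
  negative, the arc terms of the numerator have coefficients (E + E') / 2 - E and (E + E') / 2 - E',
  multiples of the sine. The ray terms already carry the sine, so it divides out.\<close>

lemma bessel_Y_quotient_eq:
  assumes t: "Re t > 0" and \<nu>: "\<nu> \<notin> \<int>"
  shows "bessel_Y_quotient \<nu> t = Y_deriv t 0 \<nu>"
proof -
  define E where "E = exp (\<i> * of_real (pi * \<nu>))"
  define E' where "E' = exp (- (\<i> * of_real (pi * \<nu>)))"
  define A B K K' where "A = arc_moment t \<i> 0 \<nu>" and "B = arc_moment t (- \<i>) 0 \<nu>"
    and "K = ray_moment t of_real 0 \<nu>" and "K' = ray_moment t of_real 0 (- \<nu>)"
  have c: "complex_of_real (cos (pi * \<nu>)) = (E + E') / 2"
    unfolding E_def E'_def by (simp only: cos_of_real[symmetric] cos_exp_eq)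
  have s: "complex_of_real (sin (pi * \<nu>)) = (E - E') / (2 * \<i>)"
    unfolding E_def E'_def by (simp only: sin_of_real[symmetric] sin_exp_eq)
  have s0: "sin (pi * \<nu>) \<noteq> 0"
  proof
    assume "sin (pi * \<nu>) = 0"
    then obtain i where "pi * \<nu> = of_int i * pi" by (auto simp: sin_zero_iff_int2)
    then have "\<nu> = of_int i" by simp
    then show False using \<nu> by auto
  qed
  have J1: "bessel_J \<nu> t = (A + B) / (2 * pi) - sin (pi * \<nu>) / pi * K'"
    unfolding bessel_J_moments[OF t] A_def B_def K'_def ..
  have J2: "bessel_J (- \<nu>) t = (E * A + E' * B) / (2 * pi) + sin (pi * \<nu>) / pi * K"
    unfolding bessel_J_moments[OF t] arc_moment_reflect A_def B_def K_def E_def E'_def by simp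
  have "ray_moment t (\<lambda>x. \<i> * pi - of_real x) 0 \<nu> = E * K'"
    and "ray_moment t (\<lambda>x. - \<i> * pi - of_real x) 0 \<nu> = E' * K'"
    unfolding ray_moment_shift E_def E'_def K'_def by (simp_all add: mult_ac)
  then have Y: "Y_deriv t 0 \<nu> = (A - B) / (2 * \<i> * pi) - (K + (E + E') / 2 * K') / pi"
    unfolding Y_deriv_def A_def[symmetric] B_def[symmetric] K_def[symmetric]
    by (simp add: algebra_simps)
  have "E - E' \<noteq> 0" using s s0 by auto
  then have "bessel_J \<nu> t * of_real (cos (pi * \<nu>)) - bessel_J (- \<nu>) t = of_real (sin (pi * \<nu>)) * Y_deriv t 0 \<nu>"
    unfolding J1 J2 c Y of_real_divide s by (simp add: field_simps)
  then show ?thesis using s0 by (simp add: bessel_Y_quotient_def)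
qed

text \<open>\<open>Y_deriv t 0\<close> is continuous, and within distance 1 of an integer order
  every other order is non-integer, so the limit defining \<open>bessel_Y\<close> there is its
  value.\<close>

lemma bessel_Y_eq:
  assumes t: "Re t > 0"
  shows "bessel_Y \<nu> t = Y_deriv t 0 \<nu>"
proof (cases "\<nu> \<in> \<int>")
  case True
  have "isCont (Y_deriv t 0) \<nu>"
    by (rule has_vector_derivative_continuous[OF has_vector_derivative_Y_deriv[OF t]])
  then have "(Y_deriv t 0 \<longlongrightarrow> Y_deriv t 0 \<nu>) (at \<nu>)"
    by (simp add: isCont_def)
  moreover have "\<forall>\<^sub>F \<mu> in at \<nu>. Y_deriv t 0 \<mu> = bessel_Y_quotient \<mu> t"
    unfolding eventually_at
  proof (intro exI[of _ 1] conjI ballI impI)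
    fix \<mu> assume \<mu>: "\<mu> \<noteq> \<nu> \<and> dist \<mu> \<nu> < 1"
    have "\<mu> \<notin> \<int>"
    proof
      assume "\<mu> \<in> \<int>"
      then obtain i j where "\<mu> = of_int i" "\<nu> = of_int j" using True by (auto elim!: Ints_cases)
      with \<mu> show False by (simp add: dist_real_def flip: of_int_diff of_int_abs)
    qed
    then show "Y_deriv t 0 \<mu> = bessel_Y_quotient \<mu> t" by (simp add: bessel_Y_quotient_eq[OF t])
  qed auto
  ultimately have "((\<lambda>\<mu>. bessel_Y_quotient \<mu> t) \<longlongrightarrow> Y_deriv t 0 \<nu>) (at \<nu>)"
    using tendsto_cong by fast
  then show ?thesis using True by (simp add: bessel_Y_def tendsto_Lim)
qed (simp add: bessel_Y_def bessel_Y_quotient_eq[OF t])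

section \<open>Iterated derivatives and return to the integrals of the theorem\<close>

lemma nth_derivative_eq:
  assumes "\<And>k x. (F k has_vector_derivative F (Suc k) x) (at x)"
  shows "nth_derivative n (F 0) = F n"
proof (induction n)
  case (Suc n)
  have "nth_derivative (Suc n) (F 0) = (\<lambda>x. vector_derivative (nth_derivative n (F 0)) (at x))"
    by (simp add: nth_derivative_def)
  also have "\<dots> = F (Suc n)"
    unfolding Suc by (intro ext vector_derivative_at assms)
  finally show ?case .
qed (simp add: nth_derivative_def)

text \<open>The shift by \<pi> n / 2 multiplies the two exponentials of the sine by (-\<i>)^n and
  \<i>^n, exactly the constants in (-s x)^n for s = \<i> and s = -\<i>.\<close>

lemma arc_moment_eq_integral:
  "(arc_moment t \<i> n \<nu> - arc_moment t (- \<i>) n \<nu>) / (2 * \<i>) =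
     integral {0..pi} (\<lambda>x. of_real (x ^ n) * sin (t * of_real (sin x) - of_real (\<nu> * x) - of_real (pi / 2 * real n)))"
proof -
  define f where "f = (\<lambda>s x. exp (s * t * of_real (sin x)) * (- s * of_real x) ^ n * exp (of_real \<nu> * (- s * of_real x)))"
  have i: "integrable (lebesgue_on {0..pi}) (f s)" for s
    unfolding f_def by (rule exp_dominated_integrable(1)[OF exp_dominated_arc])
  have eq: "of_real (x ^ n) * sin (t * of_real (sin x) - of_real (\<nu> * x) - of_real (pi / 2 * real n))
      = (f \<i> x - f (- \<i>) x) / (2 * \<i>)" for x
  proof -
    define w where "w = t * of_real (sin x) - of_real (\<nu> * x)"
    \<comment> \<open>A quarter turn in the direction given by s is multiplication by s \<i>; n such
      turns give the power.\<close>
    have q: "exp (s * (\<i> * of_real (pi / 2 * real n))) = (s * \<i>) ^ n" if "s = 1 \<or> s = -1" for s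
    proof -
      have "s * (\<i> * of_real (pi / 2 * real n)) = of_nat n * (s * (\<i> * of_real (pi / 2)))"
        by (simp add: algebra_simps)
      then have "exp (s * (\<i> * of_real (pi / 2 * real n))) = exp (s * (\<i> * of_real (pi / 2))) ^ n"
        by (simp only: exp_of_nat_mult)
      also have "exp (s * (\<i> * of_real (pi / 2))) = s * \<i>"
        using that cis_conv_exp[of "pi / 2"] by (auto simp: exp_minus)
      finally show ?thesis .
    qed
    have "exp (\<i> * (w - of_real (pi / 2 * real n))) = exp (\<i> * w) * exp (-1 * (\<i> * of_real (pi / 2 * real n)))"
      by (simp add: algebra_simps flip: exp_add)
    also have "\<dots> = exp (\<i> * w) * (- \<i>) ^ n" by (subst q) auto
    finally have 1: "of_real (x ^ n) * exp (\<i> * (w - of_real (pi / 2 * real n))) = f \<i> x"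
      unfolding f_def w_def minus_mult_left[symmetric]
      by (simp add: power_mult_distrib power_minus[of "\<i> * of_real x"] power_minus[of \<i>] algebra_simps flip: exp_add)
    have "exp (- (\<i> * (w - of_real (pi / 2 * real n)))) = exp (- (\<i> * w)) * exp (1 * (\<i> * of_real (pi / 2 * real n)))"
      by (simp add: algebra_simps flip: exp_add)
    also have "\<dots> = exp (- (\<i> * w)) * \<i> ^ n" by (subst q) auto
    finally have 2: "of_real (x ^ n) * exp (- (\<i> * (w - of_real (pi / 2 * real n)))) = f (- \<i>) x"
      unfolding f_def w_def by (simp add: power_mult_distrib algebra_simps flip: exp_add)
    show ?thesis unfolding w_def[symmetric] sin_exp_eq 1[symmetric] 2[symmetric]
      by (simp add: algebra_simps diff_divide_distrib)
  qed
  have "integral {0..pi} (\<lambda>x. of_real (x ^ n) * sin (t * of_real (sin x) - of_real (\<nu> * x) - of_real (pi / 2 * real n)))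
      = (\<integral>x. (f \<i> x - f (- \<i>) x) / (2 * \<i>) \<partial>lebesgue_on {0..pi})"
    unfolding eq using i by (intro lebesgue_integral_eq_integral[symmetric]) auto
  also have "\<dots> = (arc_moment t \<i> n \<nu> - arc_moment t (- \<i>) n \<nu>) / (2 * \<i>)"
  proof -
    have "arc_moment t s n \<nu> = (\<integral>x. f s x \<partial>lebesgue_on {0..pi})" for s
      by (simp add: arc_moment_def exp_moment_def f_def)
    then show ?thesis using i by simp
  qed
  finally show ?thesis ..
qed

text \<open>The real part is the mean of a number and its conjugate, and conjugation turns \<i>
  \<pi> - x into -\<i> \<pi> - x: hence the two averaged moments. The \<open>has_integral\<close>
  form delivers existence and value of the improper integral together.\<close>

lemma ray_moment_has_integral:
  assumes t: "Re t > 0"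
  shows "((\<lambda>x. exp (- t * of_real (sinh x)) *
       of_real (x ^ n * exp (\<nu> * x) +
         exp (- \<nu> * x) * Re ((\<i> * of_real pi - of_real x) ^ n * exp (\<i> * of_real pi * of_real \<nu>))))
    has_integral ray_moment t of_real n \<nu>
        + (ray_moment t (\<lambda>x. \<i> * pi - of_real x) n \<nu> + ray_moment t (\<lambda>x. - \<i> * pi - of_real x) n \<nu>) / 2) {0..}"
proof -
  define f where "f = (\<lambda>b x. exp (- t * of_real (sinh x)) * b x ^ n * exp (of_real \<nu> * b x))"
  define a b where "a = (\<lambda>x. \<i> * pi - complex_of_real x)" and "b = (\<lambda>x. - \<i> * pi - complex_of_real x)"
  have i: "integrable (lebesgue_on {0..}) (f of_real)" "integrable (lebesgue_on {0..}) (f a)" "integrable (lebesgue_on {0..}) (f b)"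
    unfolding f_def a_def b_def by (intro exp_dominated_integrable(1) exp_dominated_ray t)+
  have eq: "exp (- t * of_real (sinh x)) *
       of_real (x ^ n * exp (\<nu> * x) +
         exp (- \<nu> * x) * Re ((\<i> * of_real pi - of_real x) ^ n * exp (\<i> * of_real pi * of_real \<nu>)))
     = f of_real x + (f a x + f b x) / 2" for x
  proof -
    define z where "z = (\<i> * of_real pi - of_real x) ^ n * exp (\<i> * of_real pi * of_real \<nu>)"
    have cz: "cnj z = (- \<i> * of_real pi - of_real x) ^ n * exp (- \<i> * of_real pi * of_real \<nu>)"
      by (simp add: z_def exp_cnj)
    have "complex_of_real (Re z) = (z + cnj z) / 2" by (simp add: complex_add_cnj)
    moreover have "exp (of_real (- \<nu> * x)) * z = a x ^ n * exp (of_real \<nu> * a x)"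
    proof -
      have "of_real \<nu> * a x = of_real (- \<nu> * x) + \<i> * of_real pi * of_real \<nu>"
        by (simp add: a_def algebra_simps)
      then show ?thesis by (simp only: z_def a_def exp_add mult_ac)
    qed
    moreover have "exp (of_real (- \<nu> * x)) * cnj z = b x ^ n * exp (of_real \<nu> * b x)"
    proof -
      have "of_real \<nu> * b x = of_real (- \<nu> * x) + - \<i> * of_real pi * of_real \<nu>"
        by (simp add: b_def algebra_simps)
      then show ?thesis by (simp only: cz b_def exp_add mult_ac)
    qed
    ultimately have ab: "of_real (exp (- \<nu> * x)) * complex_of_real (Re z)
        = (a x ^ n * exp (of_real \<nu> * a x) + b x ^ n * exp (of_real \<nu> * b x)) / 2"
      by (simp only: exp_of_real[symmetric] times_divide_eq_right distrib_left)
    have "complex_of_real (x ^ n * exp (\<nu> * x) + exp (- \<nu> * x) * Re z)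
        = of_real x ^ n * exp (of_real \<nu> * of_real x) + of_real (exp (- \<nu> * x)) * of_real (Re z)"
      by (simp add: exp_of_real[symmetric])
    then show ?thesis
      unfolding z_def[symmetric] f_def by (simp only: ab) (simp add: algebra_simps add_divide_distrib)
  qed
  have "((\<lambda>x. f of_real x + (f a x + f b x) / 2) has_integral
      (\<integral>x. f of_real x + (f a x + f b x) / 2 \<partial>lebesgue_on {0..})) {0..}"
    using i by (intro has_integral_integral_lebesgue_on) auto
  also have "(\<integral>x. f of_real x + (f a x + f b x) / 2 \<partial>lebesgue_on {0..})
      = ray_moment t of_real n \<nu> + (ray_moment t a n \<nu> + ray_moment t b n \<nu>) / 2"
  proof -
    have "ray_moment t k n \<nu> = (\<integral>x. f k x \<partial>lebesgue_on {0..})" for k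
      by (simp add: ray_moment_def exp_moment_def f_def)
    then show ?thesis using i by simp
  qed
  finally show ?thesis unfolding eq a_def b_def .
qed

theorem mainTheorem2:
  fixes n :: nat and \<nu> :: real and t :: complex
  assumes "Re t > 0"
  shows "times_differentiable n (\<lambda>\<mu>. bessel_Y \<mu> t) \<and>
    (\<lambda>x::real. exp (- t * of_real (sinh x)) *
       of_real (x ^ n * exp (\<nu> * x) +
         exp (- \<nu> * x) * Re ((\<i> * of_real pi - of_real x) ^ n * exp (\<i> * of_real pi * of_real \<nu>))))
      integrable_on {0..} \<and>
    nth_derivative n (\<lambda>\<mu>. bessel_Y \<mu> t) \<nu> =
      1 / of_real pi * integral {0..pi} (\<lambda>x::real. of_real (x ^ n) *
        sin (t * of_real (sin x) - of_real (\<nu> * x) - of_real (pi / 2 * real n)))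
      - 1 / of_real pi * integral {0..} (\<lambda>x::real. exp (- t * of_real (sinh x)) *
          of_real (x ^ n * exp (\<nu> * x) +
            exp (- \<nu> * x) * Re ((\<i> * of_real pi - of_real x) ^ n * exp (\<i> * of_real pi * of_real \<nu>))))"
proof -
  have Y: "(\<lambda>\<mu>. bessel_Y \<mu> t) = Y_deriv t 0"
    by (intro ext bessel_Y_eq assms)
  \<comment> \<open>Stated for every k: the orders below n give differentiability, and k = n gives
    the formula.\<close>
  have nth: "nth_derivative k (\<lambda>\<mu>. bessel_Y \<mu> t) = Y_deriv t k" for k
    unfolding Y by (intro nth_derivative_eq has_vector_derivative_Y_deriv assms)
  have "times_differentiable n (\<lambda>\<mu>. bessel_Y \<mu> t)"
    unfolding times_differentiable_def nth
    using has_vector_derivative_Y_deriv[OF assms] differentiableI_vector by blast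
  moreover note has_integral_integrable[OF ray_moment_has_integral[OF assms]]
  moreover have "Y_deriv t n \<nu> =
      1 / of_real pi * ((arc_moment t \<i> n \<nu> - arc_moment t (- \<i>) n \<nu>) / (2 * \<i>))
      - 1 / of_real pi * (ray_moment t of_real n \<nu>
        + (ray_moment t (\<lambda>x. \<i> * pi - of_real x) n \<nu> + ray_moment t (\<lambda>x. - \<i> * pi - of_real x) n \<nu>) / 2)"
    by (simp add: Y_deriv_def mult_ac)
  ultimately show ?thesis
    unfolding nth integral_unique[OF ray_moment_has_integral[OF assms]] arc_moment_eq_integral[symmetric]
    by blast
qed

end
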